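(* Let $g\geq1$ and $n\geq1$ be integers and let $1\leq h\leq n$. There is a bijection $\phi:\mathfrak{S}_{n-1}\times\{0,1,\dots,n-1\}\to\mathfrak{S}_n$ such that for all $\sigma\in\mathfrak{S}_{n-1}$ and $0\leq c\leq n-1$: $$g\mathsf{Exclp}_h(\phi(\sigma,c))=\begin{cases}g\mathsf{Exclp}_h(\sigma),& 0\leq c\leq |g\mathsf{Exclp}_h(\sigma)|+g-1,\\ g\mathsf{Exclp}_h(\sigma)\cup\{k_d\},&\text{otherwise,}\end{cases}\qquad g\mathsf{den}_h(\phi(\sigma,c))=g\mathsf{den}_h(\sigma)+c,$$ where $d=c-|g\mathsf{Exclp}_h(\sigma)|-g+1$ and $k_d$ is the $d$-th smallest element of $[n-1]\setminus g\mathsf{Exclp}_h(\sigma)$.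
   Context: Permutations $\pi\in\mathfrak{S}_m$ are in one-line notation $\pi_1\cdots\pi_m$. $g\mathsf{Exclp}_h(\pi)=\{i\in[m]:\pi_i\geq i+g,\ \pi_i\geq h\}$ (the $g$-gap $h$-level excedance-letter positions). Let $g\mathrm{EXCL}_h(\pi)$ be the subsequence of $\pi$ of letters $\pi_i$ with $i\in g\mathsf{Exclp}_h(\pi)$ and $g\mathrm{NEXCL}_h(\pi)$ the subsequence of the remaining letters. For a word $u$ of distinct integers, $\mathsf{inv}(u)$ counts pairs of positions $i<j$ with $u_i>u_j$. Then $g\mathsf{den}_h(\pi)=\sum_{i\in g\mathsf{Exclp}_h(\pi)}(i+g-1)+\mathsf{inv}(g\mathrm{EXCL}_h(\pi))+\mathsf{inv}(g\mathrm{NEXCL}_h(\pi))$. *)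

theory Defs
  imports "HOL-Combinatorics.Permutations"
begin

text \<open>
  A permutation of \<open>[m] = {1..m}\<close> is a function \<open>p :: nat \<Rightarrow> nat\<close> with \<open>p permutes {1..m}\<close>; its
  one-line notation is the word \<open>p 1, \<dots>, p m\<close>.  Such a function is the identity outside
  \<open>{1..m}\<close> and does not determine \<open>m\<close>, so the size \<open>m\<close> is an explicit argument below.
\<close>

definition Sym :: "nat \<Rightarrow> (nat \<Rightarrow> nat) set" where
  "Sym m = {p. p permutes {1..m}}"

definition Exclp :: "nat \<Rightarrow> nat \<Rightarrow> nat \<Rightarrow> (nat \<Rightarrow> nat) \<Rightarrow> nat set" where
  "Exclp g h m p = {i \<in> {1..m}. p i \<ge> i + g \<and> p i \<ge> h}"

definition EXCL :: "nat \<Rightarrow> nat \<Rightarrow> nat \<Rightarrow> (nat \<Rightarrow> nat) \<Rightarrow> nat list" where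
  "EXCL g h m p = map p (filter (\<lambda>i. i \<in> Exclp g h m p) [1..<Suc m])"

definition NEXCL :: "nat \<Rightarrow> nat \<Rightarrow> nat \<Rightarrow> (nat \<Rightarrow> nat) \<Rightarrow> nat list" where
  "NEXCL g h m p = map p (filter (\<lambda>i. i \<notin> Exclp g h m p) [1..<Suc m])"

definition word_inv :: "nat list \<Rightarrow> nat" where
  "word_inv u = card {(i, j). i < j \<and> j < length u \<and> u ! i > u ! j}"

text \<open>The truncated subtraction \<open>i + g - 1\<close> is exact, as the positions satisfy \<open>i \<ge> 1\<close>.\<close>

definition den :: "nat \<Rightarrow> nat \<Rightarrow> nat \<Rightarrow> (nat \<Rightarrow> nat) \<Rightarrow> nat" where
  "den g h m p =
     (\<Sum>i\<in>Exclp g h m p. i + g - 1) + word_inv (EXCL g h m p) + word_inv (NEXCL g h m p)"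

text \<open>The \<open>d\<close>-th smallest element of a finite set, counted from \<open>d = 1\<close>;
  meaningful only for \<open>1 \<le> d \<le> card A\<close>.\<close>

definition nth_smallest :: "nat set \<Rightarrow> nat \<Rightarrow> nat" where
  "nth_smallest A d = sorted_list_of_set A ! (d - 1)"

end

theory Submission
  imports Defs "HOL-Computational_Algebra.Polynomial"
begin

text \<open>
  The bijection is obtained by counting: writing \<open>F\<^sub>n(E)\<close> for the sum of \<open>q\<close> to the two inversion
  numbers over the permutations of \<open>[n]\<close> with excedance positions \<open>E\<close>, the theorem amounts to
  \<open>F\<^sub>n(E) = [|E| + g] F\<^bsub>n-1\<^esub>(E) + (\<Sum>k\<in>E. q ^ #{i \<in> E. k < i} F\<^bsub>n-1\<^esub>(E - {k}))\<close>.
  Fix the set \<open>V\<close> of excedance letters. The excedance and the non-excedance letters then fill two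
  Ferrers boards independently, so both inversion sums are products of \<open>q\<close>-integers. Reading
  \<open>u = 1, \<dots>, n\<close>, the factor of \<open>u\<close> depends only on the number \<open>a\<close> of positions \<open>i \<in> E\<close> with
  \<open>i + g \<le> u\<close> that do not yet hold a letter below \<open>u\<close>: it is \<open>[a]\<close> if \<open>u \<in> V\<close>, and then \<open>a\<close> drops
  by one, and \<open>[g + a]\<close> otherwise. Hence \<open>F\<^sub>n(E)\<close> is a matrix element of a word in two
  operators: \<open>U\<close>, which opens a position, and \<open>D\<close>, which reads a letter. They satisfy
  \<open>D U = q U D + 1 + U\<close>, and moving the leftmost \<open>D\<close> through the word gives the recurrence.
\<close>

section \<open>Inversions of fillings of a Ferrers board\<close>

text \<open>The q-integer of \<open>k\<close>. A commutative semiring is enough, so that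
  \<open>q\<close> can later be the indeterminate of the polynomials over
  \<open>nat\<close>.\<close>

definition qint :: "'a::comm_semiring_1 \<Rightarrow> nat \<Rightarrow> 'a" where
  "qint q k = (\<Sum>i<k. q ^ i)"

lemma qint_0 [simp]: "qint q 0 = 0"
  by (simp add: qint_def)

lemma qint_Suc: "qint q (Suc k) = 1 + q * qint q k"
  unfolding qint_def by (subst sum.lessThan_Suc_shift) (simp add: sum_distrib_left)

lemma rank_less:
  fixes b :: "'b \<Rightarrow> 'c::linorder"
  assumes "finite A" and "x \<in> A" and "b x < b y"
  shows "card {z\<in>A. b z < b x} < card {z\<in>A. b z < b y}"
  by (rule psubset_card_mono) (use assms in auto)

text \<open>An injective key makes the rank a bijection from \<open>A\<close> onto the numbers below
  \<open>card A\<close>, so every exponent occurs exactly once.\<close>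

lemma sum_power_rank:
  fixes b :: "'b \<Rightarrow> 'c::linorder"
  assumes "finite A" and "inj_on b A"
  shows "(\<Sum>x\<in>A. q ^ card {y\<in>A. b y < b x}) = qint q (card A)"
proof -
  let ?r = "\<lambda>x. card {y\<in>A. b y < b x}"
  have less: "?r x < ?r y" if "x \<in> A" "b x < b y" for x y
    using assms(1) that by (rule rank_less)
  have inj: "inj_on ?r A"
  proof (rule inj_onI)
    fix x y assume "x \<in> A" "y \<in> A" "?r x = ?r y"
    then show "x = y"
      using less[of x y] less[of y x] assms(2) by (metis inj_onD linorder_neqE nat_neq_iff)
  qed
  have "?r x < card A" if "x \<in> A" for x
    by (rule psubset_card_mono) (use assms(1) that in auto)
  then have "?r ` A = {..<card A}"
    by (intro card_subset_eq) (auto simp: card_image[OF inj])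
  then show ?thesis
    unfolding qint_def by (metis (no_types, lifting) inj sum.reindex_cong)
qed

text \<open>Extensionality makes a filling determined by its values on \<open>P\<close>, so the set
  is finite and restrictions of a permutation count each filling once.\<close>

definition fillings :: "'a set \<Rightarrow> 'b set \<Rightarrow> ('a \<Rightarrow> 'b \<Rightarrow> bool) \<Rightarrow> ('a \<Rightarrow> 'b) set" where
  "fillings P Q R = {f \<in> extensional P. bij_betw f P Q \<and> (\<forall>p\<in>P. R p (f p))}"

lemma finite_fillings: "finite P \<Longrightarrow> finite Q \<Longrightarrow> finite (fillings P Q R)"
  by (rule finite_subset[OF _ finite_PiE[of P "\<lambda>_. Q"]])
    (auto simp: fillings_def PiE_def bij_betw_def)

text \<open>The keys allow both orders to be reversed at once, which turns the board of the
  non-excedances (final segments of positions) into that of the excedances (initial segments).\<close>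

definition key_inv :: "('a \<Rightarrow> int) \<Rightarrow> ('b \<Rightarrow> int) \<Rightarrow> 'a set \<Rightarrow> ('a \<Rightarrow> 'b) \<Rightarrow> nat" where
  "key_inv a b P f = card {(x, y). x \<in> P \<and> y \<in> P \<and> a x < a y \<and> b (f x) > b (f y)}"

lemma key_inv_cong: "(\<And>x. x \<in> P \<Longrightarrow> f x = f' x) \<Longrightarrow> key_inv a b P f = key_inv a b P f'"
  unfolding key_inv_def by (rule arg_cong[where f = card]) auto

text \<open>Negating both keys reverses both comparisons, so the same inversions appear with their
  two coordinates swapped.\<close>

lemma key_inv_uminus: "key_inv (\<lambda>x. - a x) (\<lambda>x. - b x) P f = key_inv a b P f"
  unfolding key_inv_def by (rule bij_betw_same_card[of prod.swap]) (auto intro!: bij_betwI[of _ _ _ prod.swap])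

text \<open>The smallest letter can only be the right member of an inversion, and it forms one with
  every position to its left.\<close>

lemma key_inv_insert_min:
  assumes "finite P" and "i \<in> P" and inj: "inj_on b (f ` P)" "inj_on f P"
    and min: "\<And>p. p \<in> P \<Longrightarrow> b (f i) \<le> b (f p)"
  shows "key_inv a b P f = card {p\<in>P. a p < a i} + key_inv a b (P - {i}) f"
proof -
  have lt: "b (f i) < b (f p)" if "p \<in> P" "p \<noteq> i" for p
    using min[OF that(1)] inj that assms(2) by (metis image_eqI inj_onD order_less_le)
  have "{(x, y). x \<in> P \<and> y \<in> P \<and> a x < a y \<and> b (f x) > b (f y)}
      = (\<lambda>p. (p, i)) ` {p\<in>P. a p < a i}
        \<union> {(x, y). x \<in> P - {i} \<and> y \<in> P - {i} \<and> a x < a y \<and> b (f x) > b (f y)}" (is "?A = ?B \<union> ?C")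
    using lt min assms(2) by (fastforce simp: not_le[symmetric])
  moreover have "finite ?C"
    by (rule finite_subset[of _ "P \<times> P"]) (use assms(1) in auto)
  moreover have "?B \<inter> ?C = {}" by auto
  ultimately have "card ?A = card ?B + card ?C"
    using assms(1) by (simp add: card_Un_disjoint)
  moreover have "card ?B = card {p\<in>P. a p < a i}"
    by (rule card_image) (simp add: inj_on_def)
  ultimately show ?thesis unfolding key_inv_def by simp
qed

text \<open>Place the smallest letter first: each position open to it is also open to every other letter,
  so its choice does not affect the number of choices left for them.\<close>

lemma sum_fillings:
  fixes q :: "'r::comm_semiring_1"
  assumes "finite P" "finite Q" "card P = card Q" "inj_on a P" "inj_on b Q"
    and "\<And>p p' v v'. \<lbrakk>p \<in> P; p' \<in> P; v \<in> Q; v' \<in> Q; R p v; a p' \<le> a p; b v \<le> b v'\<rbrakk> \<Longrightarrow> R p' v'"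
  shows "(\<Sum>f\<in>fillings P Q R. q ^ key_inv a b P f)
    = (\<Prod>v\<in>Q. qint q (card {p\<in>P. R p v} - card {w\<in>Q. b w < b v}))"
  using assms
proof (induction "card Q" arbitrary: P Q)
  case 0
  then have "P = {}" "Q = {}" by auto
  then have "fillings P Q R = {\<lambda>_. undefined}"
    by (auto simp: fillings_def bij_betw_def)
  then show ?case using \<open>P = {}\<close> \<open>Q = {}\<close> by (simp add: key_inv_def)
next
  case (Suc k)
  note mono = Suc.prems(6)
  have "Q \<noteq> {}" using Suc.hyps(2) by auto
  then obtain v where v: "v \<in> Q" "\<And>w. w \<in> Q \<Longrightarrow> b v \<le> b w"
    using arg_min_if_finite(1)[OF Suc.prems(2), of b] arg_min_least[OF Suc.prems(2), of _ b] by blast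
  have vlt: "b v < b w" if "w \<in> Q" "w \<noteq> v" for w
    using v that Suc.prems(5) by (metis inj_onD order_less_le)
  define I where "I = {p\<in>P. R p v}"
  define inv where "inv = key_inv a b"
  define F where "F i = fillings (P - {i}) (Q - {v}) R" for i
  \<comment> \<open>\<open>?j\<close> removes the smallest letter \<open>v\<close> together with its
    position, and \<open>?i\<close> puts it back. They are mutually inverse between
    \<open>fillings P Q R\<close> and \<open>Sigma I F\<close>.\<close>
  let ?j = "\<lambda>f. (inv_into P f v, restrict f (P - {inv_into P f v}))"
  let ?i = "\<lambda>(i, f). f(i := v)"
  have fin: "finite I" using Suc.prems(1) by (simp add: I_def)
  have upd: "f(i := v) \<in> fillings P Q R \<and> inv_into P (f(i := v)) v = i
      \<and> inv P (f(i := v)) = card {p\<in>I. a p < a i} + inv (P - {i}) f"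
    if "i \<in> I" "f \<in> F i" for i f
  proof -
    let ?f = "f(i := v)"
    have i: "i \<in> P" "R i v" and f: "f \<in> extensional (P - {i})" "bij_betw f (P - {i}) (Q - {v})"
      "\<forall>p\<in>P - {i}. R p (f p)" using that by (auto simp: I_def F_def fillings_def)
    have "bij_betw ?f (P - {i} \<union> {i}) (Q - {v} \<union> {v})"
      by (rule bij_betw_combine) (use f(2) in \<open>auto simp: bij_betw_def inj_on_def\<close>)
    then have bij: "bij_betw ?f P Q" using i v by (simp add: insert_absorb)
    have mem: "?f \<in> fillings P Q R"
      using f i bij by (auto simp: fillings_def extensional_def)
    have inv: "inv_into P ?f v = i"
      using bij i by (metis bij_betw_inv_into_left fun_upd_same)
    have "inv P ?f = card {p\<in>P. a p < a i} + inv (P - {i}) ?f"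
      unfolding inv_def
    proof (rule key_inv_insert_min)
      show "inj_on b (?f ` P)" "inj_on ?f P"
        using bij Suc.prems(5) by (simp_all add: bij_betw_def)
      show "b (?f i) \<le> b (?f p)" if "p \<in> P" for p
        using v(2)[OF bij_betw_apply[OF bij that]] by simp
    qed (use Suc.prems(1) i in auto)
    moreover have "inv (P - {i}) ?f = inv (P - {i}) f"
      unfolding inv_def by (rule key_inv_cong) auto
    \<comment> \<open>Every position left of one that is open to \<open>v\<close> is itself open to
      \<open>v\<close>, so the inversions with \<open>v\<close> are counted by the rank of
      \<open>i\<close> within \<open>I\<close>.\<close>
    moreover have "{p\<in>P. a p < a i} = {p\<in>I. a p < a i}"
      using mono[OF i(1) _ v(1) v(1) i(2)] by (auto simp: I_def)
    ultimately show ?thesis using mem inv by simp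
  qed
  have "(\<Sum>f\<in>fillings P Q R. q ^ inv P f)
      = (\<Sum>(i, f)\<in>Sigma I F. q ^ card {p\<in>I. a p < a i} * q ^ inv (P - {i}) f)"
  proof (rule sum.reindex_bij_witness[where j = ?j and i = ?i])
    fix f assume f: "f \<in> fillings P Q R"
    let ?p = "inv_into P f v"
    have bij: "bij_betw f P Q" using f by (simp add: fillings_def)
    have p: "?p \<in> P" "f ?p = v"
      using bij v by (auto simp: bij_betw_def inv_into_into f_inv_into_f)
    show eq: "?i (?j f) = f"
      using f p by (auto simp: fillings_def extensional_def restrict_def fun_eq_iff)
    have "bij_betw (restrict f (P - {?p})) (P - {?p}) (Q - {v})"
      using bij_betw_DiffI[OF bij, of "{?p}" "{v}"] p v by (simp add: bij_betw_restrict_eq)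
    then show mem: "?j f \<in> Sigma I F"
      using f p by (auto simp: fillings_def I_def F_def)
    show "(case ?j f of (i, f) \<Rightarrow> q ^ card {p\<in>I. a p < a i} * q ^ inv (P - {i}) f) = q ^ inv P f"
      using upd[of ?p "snd (?j f)"] mem eq by (auto simp: power_add)
  next
    fix x assume "x \<in> Sigma I F"
    then obtain i f where x: "x = (i, f)" "i \<in> I" "f \<in> F i" by auto
    have "restrict (f(i := v)) (P - {i}) = f"
      using x by (auto simp: F_def fillings_def extensional_def restrict_def fun_eq_iff)
    then show "?j (?i x) = x" "?i x \<in> fillings P Q R"
      using upd[OF x(2,3)] x by auto
  qed
  also have "\<dots> = (\<Sum>i\<in>I. \<Sum>f\<in>F i. q ^ card {p\<in>I. a p < a i} * q ^ inv (P - {i}) f)"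
    by (rule sum.Sigma[symmetric]) (use fin Suc.prems in \<open>auto simp: F_def intro: finite_fillings\<close>)
  also have "\<dots> = (\<Sum>i\<in>I. q ^ card {p\<in>I. a p < a i}) *
      (\<Prod>w\<in>Q - {v}. qint q (card {p\<in>P. R p w} - card {u\<in>Q. b u < b w}))"
    unfolding sum_distrib_right
  proof (rule sum.cong[OF refl])
    fix i assume i: "i \<in> I"
    have "(\<Sum>f\<in>F i. q ^ inv (P - {i}) f)
        = (\<Prod>w\<in>Q - {v}. qint q (card {p\<in>P - {i}. R p w} - card {u\<in>Q - {v}. b u < b w}))"
      unfolding F_def inv_def
    proof (rule Suc.hyps(1))
      show "k = card (Q - {v})" "card (P - {i}) = card (Q - {v})"
        using Suc i v by (auto simp: I_def)
      show "inj_on a (P - {i})" "inj_on b (Q - {v})"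
        using Suc.prems(4,5) by (auto intro: inj_on_diff)
      show "R p' w'" if "p \<in> P - {i}" "p' \<in> P - {i}" "w \<in> Q - {v}" "w' \<in> Q - {v}"
        "R p w" "a p' \<le> a p" "b w \<le> b w'" for p p' w w'
        using mono[of p p' w w'] that by simp
    qed (use Suc.prems(1,2) in simp_all)
    also have "\<dots> = (\<Prod>w\<in>Q - {v}. qint q (card {p\<in>P. R p w} - card {u\<in>Q. b u < b w}))"
    proof (rule prod.cong[OF refl])
      fix w assume w: "w \<in> Q - {v}"
      \<comment> \<open>Position \<open>i\<close> is open to \<open>w\<close> too, and
        \<open>v\<close> precedes \<open>w\<close>. Both cardinalities thus drop by one and the
        truncated difference is unchanged.\<close>
      have "{p\<in>P. R p w} = insert i {p\<in>P - {i}. R p w}"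
        using mono[of i i v w] i v w by (auto simp: I_def)
      moreover have "{u\<in>Q. b u < b w} = insert v {u\<in>Q - {v}. b u < b w}"
        using v vlt w by auto
      ultimately show "qint q (card {p\<in>P - {i}. R p w} - card {u\<in>Q - {v}. b u < b w})
          = qint q (card {p\<in>P. R p w} - card {u\<in>Q. b u < b w})"
        using Suc.prems(1,2) by simp
    qed
    finally show "(\<Sum>f\<in>F i. q ^ card {p\<in>I. a p < a i} * q ^ inv (P - {i}) f)
        = q ^ card {p\<in>I. a p < a i} *
          (\<Prod>w\<in>Q - {v}. qint q (card {p\<in>P. R p w} - card {u\<in>Q. b u < b w}))"
      by (simp add: sum_distrib_left[symmetric])
  qed
  also have "(\<Sum>i\<in>I. q ^ card {p\<in>I. a p < a i}) = qint q (card I)"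
    by (rule sum_power_rank[OF fin]) (use Suc.prems(4) in \<open>auto simp: I_def inj_on_def\<close>)
  \<comment> \<open>No letter lies below \<open>v\<close>; subtracting this zero gives the factor of
    \<open>v\<close> the shape of the product.\<close>
  also have "card I = card {p\<in>P. R p v} - card {w\<in>Q. b w < b v}"
  proof -
    have "{w\<in>Q. b w < b v} = {}" using v(2) leD by blast
    then show ?thesis unfolding I_def by (simp only: card.empty diff_zero)
  qed
  finally show ?case
    unfolding inv_def using Suc.prems(2) v(1) by (subst prod.remove[of Q v]) auto
qed

section \<open>Splitting a permutation into its two subwords\<close>

text \<open>A permutation whose positions satisfying \<open>R\<close> are exactly those in
  \<open>E\<close> amounts to the image \<open>V\<close> of \<open>E\<close> and two independent
  fillings, one of the board and one of its complement.\<close>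

lemma sum_permutes_split:
  fixes F G :: "('a \<Rightarrow> 'a) \<Rightarrow> 'r::comm_semiring_1"
  assumes "finite S" and "E \<subseteq> S"
  shows "(\<Sum>p | p permutes S \<and> {i\<in>S. R i (p i)} = E. F (restrict p E) * G (restrict p (S - E)))
    = (\<Sum>V | V \<subseteq> S \<and> card V = card E.
        (\<Sum>f\<in>fillings E V R. F f) * (\<Sum>f\<in>fillings (S - E) (S - V) (\<lambda>i v. \<not> R i v). G f))"
proof -
  let ?N = "\<lambda>i v. \<not> R i v"
  let ?A = "\<lambda>V. fillings E V R" and ?B = "\<lambda>V. fillings (S - E) (S - V) ?N"
  let ?W = "{V. V \<subseteq> S \<and> card V = card E}"
  let ?j = "\<lambda>p. (p ` E, restrict p E, restrict p (S - E))"
  let ?i = "\<lambda>(V, f, f') x. if x \<in> E then f x else if x \<in> S then f' x else x"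
  have "(\<Sum>V\<in>?W. (\<Sum>f\<in>?A V. F f) * (\<Sum>f\<in>?B V. G f))
      = (\<Sum>V\<in>?W. \<Sum>(f, f')\<in>?A V \<times> ?B V. F f * G f')"
    by (simp add: sum_product sum.cartesian_product)
  also have "\<dots> = (\<Sum>(V, f, f')\<in>Sigma ?W (\<lambda>V. ?A V \<times> ?B V). F f * G f')"
    by (subst sum.Sigma)
      (use assms in \<open>auto intro!: finite_cartesian_product finite_fillings intro: finite_subset\<close>)
  also have "\<dots> = (\<Sum>p | p permutes S \<and> {i\<in>S. R i (p i)} = E. F (restrict p E) * G (restrict p (S - E)))"
  proof (rule sum.reindex_bij_witness[where j = ?i and i = ?j])
    fix p assume "p \<in> {p. p permutes S \<and> {i\<in>S. R i (p i)} = E}"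
    then have p: "p permutes S" "{i\<in>S. R i (p i)} = E" by auto
    have inj: "inj_on p E" "inj_on p (S - E)"
      using permutes_inj[OF p(1)] by (auto intro: inj_on_subset)
    have "p ` (S - E) = S - p ` E"
      using permutes_inj[OF p(1)] permutes_image[OF p(1)] by (simp add: image_set_diff)
    then show "?j p \<in> Sigma ?W (\<lambda>V. ?A V \<times> ?B V)"
      using p(2) assms inj permutes_image[OF p(1)] card_image[OF inj(1)]
      by (auto simp: fillings_def bij_betw_def)
    show "?i (?j p) = p"
      using permutes_not_in[OF p(1)] assms(2) by (auto simp: fun_eq_iff)
  next
    fix x assume "x \<in> Sigma ?W (\<lambda>V. ?A V \<times> ?B V)"
    then obtain V f f' where x: "x = (V, f, f')" and V: "V \<subseteq> S"
      and f: "f \<in> extensional E" "bij_betw f E V" "\<forall>p\<in>E. R p (f p)"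
      and f': "f' \<in> extensional (S - E)" "bij_betw f' (S - E) (S - V)" "\<forall>p\<in>S - E. \<not> R p (f' p)"
      by (auto simp: fillings_def)
    let ?p = "\<lambda>x. if x \<in> E then f x else if x \<in> S then f' x else x"
    have 1: "bij_betw ?p E V" "bij_betw ?p (S - E) (S - V)"
      by (rule bij_betw_cong[THEN iffD1, OF _ f(2)], simp)
        (rule bij_betw_cong[THEN iffD1, OF _ f'(2)], simp)
    have "bij_betw ?p (E \<union> (S - E)) (V \<union> (S - V))"
      by (rule bij_betw_combine[OF 1]) auto
    then have "bij_betw ?p S S"
      using V assms(2) by (simp add: Un_absorb1)
    then have "?p permutes S"
      by (rule bij_imp_permutes) (use assms(2) in auto)
    moreover have "{i\<in>S. R i (?p i)} = E"
      using assms(2) f(3) f'(3) by auto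
    ultimately show "?i x \<in> {p. p permutes S \<and> {i\<in>S. R i (p i)} = E}"
      using x by simp
    have r: "restrict ?p E = f" "restrict ?p (S - E) = f'"
      using f(1) f'(1) by (auto simp: fun_eq_iff restrict_def extensional_def)
    show "?j (?i x) = x"
      using r bij_betw_imp_surj_on[OF 1(1)] x by simp
    show "F (restrict (?i x) E) * G (restrict (?i x) (S - E)) = (case x of (V, f, f') \<Rightarrow> F f * G f')"
      using r x by simp
  qed
  finally show ?thesis by simp
qed

text \<open>The \<open>F\<^sub>n(E)\<close> of the overview. The position sum in \<open>den\<close>
  is left out because it depends on \<open>E\<close> only.\<close>

definition exc_gf :: "'r::comm_semiring_1 \<Rightarrow> nat \<Rightarrow> nat \<Rightarrow> nat \<Rightarrow> nat set \<Rightarrow> 'r" where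
  "exc_gf q g h n E = (\<Sum>p | p \<in> Sym n \<and> Exclp g h n p = E.
     q ^ (key_inv int int E p + key_inv int int ({1..n} - E) p))"

text \<open>\<open>sum_fillings\<close> evaluates both boards. A position open to a non-excedance
  letter leaves all larger positions and all smaller letters admissible, so the second board is
  monotone for the negated keys.\<close>

lemma exc_gf_eq_sum_prod:
  assumes "E \<subseteq> {1..n}"
  shows "exc_gf q g h n E = (\<Sum>V | V \<subseteq> {1..n} \<and> card V = card E.
    (\<Prod>v\<in>V. qint q (card {i\<in>E. i + g \<le> v \<and> h \<le> v} - card {w\<in>V. w < v})) *
    (\<Prod>u\<in>{1..n} - V. qint q (card {i\<in>{1..n} - E. \<not> (i + g \<le> u \<and> h \<le> u)} - card {w\<in>{1..n} - V. u < w})))"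
proof -
  let ?R = "\<lambda>i v. i + g \<le> v \<and> h \<le> v"
  let ?m = "\<lambda>x. - int x"
  have "exc_gf q g h n E = (\<Sum>p | p permutes {1..n} \<and> {i\<in>{1..n}. ?R i (p i)} = E.
      q ^ key_inv int int E (restrict p E) *
      q ^ key_inv ?m ?m ({1..n} - E) (restrict p ({1..n} - E)))"
    unfolding exc_gf_def
  proof (rule sum.cong)
    fix p
    show "q ^ (key_inv int int E p + key_inv int int ({1..n} - E) p) =
      q ^ key_inv int int E (restrict p E) *
      q ^ key_inv ?m ?m ({1..n} - E) (restrict p ({1..n} - E))"
      unfolding key_inv_uminus power_add
      by (rule arg_cong2[where f = "\<lambda>x y. q ^ x * q ^ y"]; rule key_inv_cong) simp_all
  qed (simp add: Sym_def Exclp_def)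
  also have "\<dots> = (\<Sum>V | V \<subseteq> {1..n} \<and> card V = card E.
      (\<Sum>f\<in>fillings E V ?R. q ^ key_inv int int E f) *
      (\<Sum>f\<in>fillings ({1..n} - E) ({1..n} - V) (\<lambda>i v. \<not> ?R i v). q ^ key_inv ?m ?m ({1..n} - E) f))"
    by (rule sum_permutes_split) (use assms in auto)
  also have "\<dots> = (\<Sum>V | V \<subseteq> {1..n} \<and> card V = card E.
    (\<Prod>v\<in>V. qint q (card {i\<in>E. i + g \<le> v \<and> h \<le> v} - card {w\<in>V. int w < int v})) *
    (\<Prod>u\<in>{1..n} - V. qint q (card {i\<in>{1..n} - E. \<not> (i + g \<le> u \<and> h \<le> u)} - card {w\<in>{1..n} - V. ?m w < ?m u})))"
  proof (rule sum.cong[OF refl])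
    fix V assume "V \<in> {V. V \<subseteq> {1..n} \<and> card V = card E}"
    then have V: "V \<subseteq> {1..n}" "card V = card E" by auto
    have fin: "finite V" "finite E" using V(1) assms by (auto intro: finite_subset)
    have "(\<Sum>f\<in>fillings E V ?R. q ^ key_inv int int E f)
        = (\<Prod>v\<in>V. qint q (card {i\<in>E. ?R i v} - card {w\<in>V. int w < int v}))"
      by (rule sum_fillings) (use fin V in \<open>auto simp: inj_on_def\<close>)
    moreover have "(\<Sum>f\<in>fillings ({1..n} - E) ({1..n} - V) (\<lambda>i v. \<not> ?R i v).
          q ^ key_inv ?m ?m ({1..n} - E) f)
        = (\<Prod>u\<in>{1..n} - V. qint q (card {i\<in>{1..n} - E. \<not> ?R i u} - card {w\<in>{1..n} - V. ?m w < ?m u}))"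
      by (rule sum_fillings) (use fin V assms in \<open>auto simp: inj_on_def card_Diff_subset\<close>)
    ultimately show "(\<Sum>f\<in>fillings E V ?R. q ^ key_inv int int E f) *
      (\<Sum>f\<in>fillings ({1..n} - E) ({1..n} - V) (\<lambda>i v. \<not> ?R i v). q ^ key_inv ?m ?m ({1..n} - E) f)
      = (\<Prod>v\<in>V. qint q (card {i\<in>E. ?R i v} - card {w\<in>V. int w < int v})) *
        (\<Prod>u\<in>{1..n} - V. qint q (card {i\<in>{1..n} - E. \<not> ?R i u} - card {w\<in>{1..n} - V. ?m w < ?m u}))"
      by (rule arg_cong2)
  qed
  finally show ?thesis by simp
qed

section \<open>The operator calculus\<close>

text \<open>The operators \<open>D\<close> and \<open>U\<close>, acting on functions of the number \<open>a\<close> of open positions.\<close>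

definition lower :: "'r::comm_semiring_1 \<Rightarrow> nat \<Rightarrow> (nat \<Rightarrow> 'r) \<Rightarrow> nat \<Rightarrow> 'r" where
  "lower q g f a = qint q (g + a) * f a + qint q (Suc a) * f (Suc a)"

definition raise :: "(nat \<Rightarrow> 'r::comm_semiring_1) \<Rightarrow> nat \<Rightarrow> 'r" where
  "raise f a = (if a = 0 then 0 else f (a - 1))"

lemma raise_simps [simp]: "raise f 0 = 0" "raise f (Suc a) = f a"
  by (simp_all add: raise_def)

text \<open>The commutation relation is the rule \<open>qint_Suc\<close> applied to the two
  coefficients of \<open>lower\<close>: their constant terms produce the summands
  \<open>raise f a\<close> and \<open>f a\<close>.\<close>

lemma lower_raise: "lower q g (raise f) a = q * raise (lower q g f) a + f a + raise f a"
  by (cases a) (simp_all add: lower_def qint_Suc algebra_simps)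

lemma lower_linear:
  "lower q g (\<lambda>a. c * f a + (\<Sum>k\<in>S. d k * F k a)) a
    = c * lower q g f a + (\<Sum>k\<in>S. d k * lower q g (F k) a)"
  by (simp add: lower_def algebra_simps sum_distrib_left sum.distrib)

text \<open>The \<open>j\<close> steps \<open>t, \<dots>, t + j - 1\<close>, where no letter below \<open>t\<close> is an excedance letter.\<close>

primrec walk :: "'r::comm_semiring_1 \<Rightarrow> nat \<Rightarrow> nat \<Rightarrow> nat set \<Rightarrow> nat \<Rightarrow> nat \<Rightarrow> 'r" where
  "walk q g t E 0 = (\<lambda>a. if a = card {i\<in>E. i + g < t} then 1 else 0)"
| "walk q g t E (Suc j) =
    lower q g (if \<exists>i\<in>E. i + g = t + j then raise (walk q g t E j) else walk q g t E j)"

lemma walk_cong: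
  "{i\<in>E. i + g < t + j} = {i\<in>E'. i + g < t + j} \<Longrightarrow> walk q g t E j = walk q g t E' j"
proof (induction j)
  case (Suc j)
  have mem: "i \<in> E \<longleftrightarrow> i \<in> E'" if "i + g < t + Suc j" for i
    using Suc.prems that by blast
  have "(\<exists>i\<in>E. i + g = t + j) \<longleftrightarrow> (\<exists>i\<in>E'. i + g = t + j)"
    using mem by (metis add_Suc_right lessI)
  moreover have "{i\<in>E. i + g < t + j} = {i\<in>E'. i + g < t + j}"
    using mem by (metis (no_types, lifting) add_Suc_right less_SucI)
  ultimately show ?case using Suc.IH by simp
qed simp

text \<open>The identity got by moving \<open>D\<close> to the right end of the word.\<close>

lemma lower_walk:
  assumes "finite E"
  shows "lower q g (walk q g t E j) a = qint q (g + card {i\<in>E. i + g < t + j}) * walk q g t E j a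
    + (\<Sum>k | k \<in> E \<and> k + g < t + j. q ^ card {i\<in>E. k < i \<and> i + g < t + j} * walk q g t (E - {k}) j a)"
proof (induction j arbitrary: a)
  case 0
  let ?S = "{i\<in>E. i + g < t}"
  have fin: "finite ?S" using assms by simp
  \<comment> \<open>The exponent of \<open>k\<close> is its rank counted from the top, hence the
    negated key. Deleting any \<open>k\<close> of \<open>?S\<close> lowers the starting state by
    one.\<close>
  have "(\<Sum>k\<in>?S. q ^ card {i\<in>E. k < i \<and> i + g < t} * walk q g t (E - {k}) 0 a)
      = (\<Sum>k\<in>?S. q ^ card {i\<in>?S. - int i < - int k} * (if Suc a = card ?S then 1 else 0))"
  proof (rule sum.cong[OF refl])
    fix k assume k: "k \<in> ?S"
    have "{i \<in> E - {k}. i + g < t} = ?S - {k}" by auto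
    moreover have "Suc (card (?S - {k})) = card ?S"
      using card_Suc_Diff1[OF fin k] .
    moreover have "{i\<in>E. k < i \<and> i + g < t} = {i\<in>?S. - int i < - int k}" by auto
    ultimately show "q ^ card {i\<in>E. k < i \<and> i + g < t} * walk q g t (E - {k}) 0 a
      = q ^ card {i\<in>?S. - int i < - int k} * (if Suc a = card ?S then 1 else 0)"
      by (auto simp del: mem_Collect_eq)
  qed
  also have "\<dots> = qint q (card ?S) * (if Suc a = card ?S then 1 else 0)"
    unfolding sum_distrib_right[symmetric]
    by (subst sum_power_rank[OF fin]) (auto simp: inj_on_def)
  finally show ?case by (simp add: lower_def)
next
  case (Suc j)
  let ?S = "{k. k \<in> E \<and> k + g < t + j}"
  let ?d = "\<lambda>k. q ^ card {i\<in>E. k < i \<and> i + g < t + j}"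
  \<comment> \<open>The hypothesis is needed as an equation between functions, since another
    \<open>lower\<close> or \<open>raise\<close> is applied to it.\<close>
  have IH: "lower q g (walk q g t E j) = (\<lambda>a. qint q (g + card ?S) * walk q g t E j a
      + (\<Sum>k\<in>?S. ?d k * walk q g t (E - {k}) j a))"
    using Suc.IH by auto
  show ?case
  proof (cases "\<exists>i\<in>E. i + g = t + j")
    case False
    then have eq: "i + g < t + Suc j \<longleftrightarrow> i + g < t + j" if "i \<in> E" for i
      using that by (auto simp: less_Suc_eq)
    have 1: "{k. k \<in> E \<and> k + g < t + Suc j} = ?S" using eq by auto
    have 2: "{i\<in>E. k < i \<and> i + g < t + Suc j} = {i\<in>E. k < i \<and> i + g < t + j}" for k
      using eq by auto
    have 3: "walk q g t (E - {k}) (Suc j) = lower q g (walk q g t (E - {k}) j)" for k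
      using False by simp
    have "walk q g t E (Suc j) = lower q g (walk q g t E j)" using False by simp
    moreover have "lower q g (lower q g (walk q g t E j)) a
        = qint q (g + card ?S) * lower q g (walk q g t E j) a
          + (\<Sum>k\<in>?S. ?d k * lower q g (walk q g t (E - {k}) j) a)"
      unfolding lower_linear[symmetric] by (subst IH) (rule refl)
    ultimately show ?thesis
      unfolding 1 2 3 by (simp only:)
  next
    case True
    then obtain l where l: "l \<in> E" "l + g = t + j" by auto
    have lS: "l \<notin> ?S" "finite ?S" using l assms by auto
    have 1: "{k. k \<in> E \<and> k + g < t + Suc j} = insert l ?S"
      using l by (auto simp: less_Suc_eq)
    \<comment> \<open>The position \<open>l\<close> opened last lies above every \<open>k\<close> in
      \<open>?S\<close>; this accounts for the factor \<open>q\<close> in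
      \<open>q U D\<close>.\<close>
    have 2: "q ^ card {i\<in>E. k < i \<and> i + g < t + Suc j} = q * ?d k" if "k \<in> ?S" for k
    proof -
      have "{i\<in>E. k < i \<and> i + g < t + Suc j} = insert l {i\<in>E. k < i \<and> i + g < t + j}"
        using l that by (auto simp: less_Suc_eq)
      then show ?thesis using l assms by simp
    qed
    have 3: "{i\<in>E. l < i \<and> i + g < t + Suc j} = {}" using l by auto
    have 4: "walk q g t (E - {k}) (Suc j) = lower q g (raise (walk q g t (E - {k}) j))"
      if "k \<in> ?S" for k using l that by auto
    \<comment> \<open>Without \<open>l\<close> the last step contains no \<open>raise\<close>, so
      the summand \<open>1\<close> of the commutation relation becomes the term for
      \<open>k = l\<close>.\<close>
    have "walk q g t (E - {l}) j = walk q g t E j"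
      by (rule walk_cong) (use l in auto)
    then have 5: "walk q g t (E - {l}) (Suc j) = lower q g (walk q g t E j)"
      using l by auto
    have 6: "walk q g t E (Suc j) = lower q g (raise (walk q g t E j))" using True by simp
    have "lower q g (walk q g t E (Suc j)) a = q * lower q g (raise (lower q g (walk q g t E j))) a
        + lower q g (walk q g t E j) a + walk q g t E (Suc j) a"
    proof -
      have "walk q g t E (Suc j) = (\<lambda>a. q * raise (lower q g (walk q g t E j)) a
          + walk q g t E j a + raise (walk q g t E j) a)"
        unfolding 6 by (rule ext) (rule lower_raise)
      then have "lower q g (walk q g t E (Suc j)) a = q * lower q g (raise (lower q g (walk q g t E j))) a
        + lower q g (walk q g t E j) a + lower q g (raise (walk q g t E j)) a"
        by (simp add: lower_def algebra_simps)
      then show ?thesis using 6 by simp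
    qed
    also have "raise (lower q g (walk q g t E j)) = (\<lambda>a. qint q (g + card ?S) * raise (walk q g t E j) a
      + (\<Sum>k\<in>?S. ?d k * raise (walk q g t (E - {k}) j) a))"
      unfolding IH by (rule ext) (simp add: raise_def)
    also have "lower q g \<dots> a = qint q (g + card ?S) * walk q g t E (Suc j) a
      + (\<Sum>k\<in>?S. ?d k * walk q g t (E - {k}) (Suc j) a)"
      unfolding lower_linear 6 using 4 by simp
    \<comment> \<open>The summand \<open>U\<close> supplies one more copy of
      \<open>walk q g t E (Suc j) a\<close>. By \<open>qint_Suc\<close> this turns
      \<open>1 + q * qint q (g + card ?S)\<close> into the coefficient for
      \<open>insert l ?S\<close>.\<close>
    finally have "lower q g (walk q g t E (Suc j)) a
      = qint q (g + card (insert l ?S)) * walk q g t E (Suc j) a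
      + ((\<Sum>k\<in>?S. q * ?d k * walk q g t (E - {k}) (Suc j) a) + walk q g t (E - {l}) (Suc j) a)"
      unfolding 5 using lS by (simp add: qint_Suc algebra_simps sum_distrib_left)
    moreover have "(\<Sum>k\<in>?S. q ^ card {i\<in>E. k < i \<and> i + g < t + Suc j} * walk q g t (E - {k}) (Suc j) a)
        = (\<Sum>k\<in>?S. q * ?d k * walk q g t (E - {k}) (Suc j) a)"
      by (rule sum.cong[OF refl]) (simp only: 2)
    ultimately show ?thesis
      unfolding 1 sum.insert[OF lS(2,1)] 3 card.empty power_0 mult_1_left by (simp only: add.commute)
  qed
qed

text \<open>The difference between the two cardinalities is the number of open positions just before
  \<open>u\<close> is read, so \<open>V\<close> records the whole trajectory of that number.\<close>

definition step_weight :: "'r::comm_semiring_1 \<Rightarrow> nat \<Rightarrow> nat set \<Rightarrow> nat set \<Rightarrow> nat \<Rightarrow> 'r" where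
  "step_weight q g E V u =
    (if u \<in> V then qint q (card {i\<in>E. i + g \<le> u} - card {w\<in>V. w < u})
     else qint q (g + card {i\<in>E. i + g \<le> u} - card {w\<in>V. w < u}))"

text \<open>Truncated subtraction is harmless in the weights: sets \<open>V\<close> that would make the number of open
  positions negative contribute \<open>0\<close>.\<close>

lemma prod_step_weight_eq_0:
  assumes "finite E" and "V \<subseteq> {t..<m}" and "card {i\<in>E. i + g < m} < card V"
  shows "(\<Prod>u\<in>{t..<m}. step_weight q g E V u) = 0"
proof -
  have fin: "finite V" and ne: "V \<noteq> {}" using assms by (auto intro: finite_subset)
  \<comment> \<open>When the largest element is read, \<open>card V - 1\<close> letters of
    \<open>V\<close> are already placed and at most that many positions have been opened, so its
    factor is \<open>qint q 0\<close>.\<close>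
  let ?v = "Max V"
  have v: "?v \<in> V" "?v < m" using assms(2) fin ne Max_in[of V] by auto
  have "{w\<in>V. w < ?v} = V - {?v}" using fin Max_ge[OF fin] by (auto simp: less_le)
  then have "card {w\<in>V. w < ?v} = card V - 1" using v by simp
  moreover have "card {i\<in>E. i + g \<le> ?v} \<le> card {i\<in>E. i + g < m}"
    by (rule card_mono) (use assms(1) v in auto)
  ultimately have "step_weight q g E V ?v = 0" using v(1) assms(3) by (simp add: step_weight_def)
  then show ?thesis using v assms(2) by (intro prod_zero) auto
qed

text \<open>Expanding the operator word gives a sum over trajectories: \<open>V\<close> is the set
  of steps at which a position is filled, and the final state \<open>a\<close> fixes its
  cardinality.\<close>

lemma walk_eq_sum:
  fixes q :: "'r::comm_semiring_1"
  assumes "finite E"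
  shows "walk q g t E j a = (\<Sum>V | V \<subseteq> {t..<t + j} \<and> card V + a = card {i\<in>E. i + g < t + j}.
    \<Prod>u\<in>{t..<t + j}. step_weight q g E V u)"
proof (induction j arbitrary: a)
  case 0
  have eq: "{V. V \<subseteq> {t..<t + 0} \<and> card V + a = card {i\<in>E. i + g < t + 0}}
      = (if a = card {i\<in>E. i + g < t} then {{}} else {})" by auto
  show ?case unfolding eq by simp
next
  case (Suc j)
  let ?T = "{t..<t + j}" and ?m = "t + j"
  let ?N = "card {i\<in>E. i + g < ?m}" and ?N' = "card {i\<in>E. i + g < t + Suc j}"
  let ?w = "step_weight q g E"
  let ?f = "if \<exists>i\<in>E. i + g = ?m then raise (walk q g t E j) else walk q g t E j"
  let ?P = "\<lambda>a. {V. V \<subseteq> ?T \<and> card V + a = ?N'}"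
  have f: "?f a = (\<Sum>V\<in>?P a. \<Prod>u\<in>?T. ?w V u)" for a
  proof (cases "\<exists>i\<in>E. i + g = ?m")
    case False
    then have "{i\<in>E. i + g < t + Suc j} = {i\<in>E. i + g < ?m}" by (auto simp: less_Suc_eq)
    then show ?thesis using False Suc.IH by simp
  next
    case True
    then obtain l where l: "l \<in> E" "l + g = ?m" by auto
    then have "{i\<in>E. i + g < t + Suc j} = insert l {i\<in>E. i + g < ?m}" by (auto simp: less_Suc_eq)
    then have N: "?N' = Suc ?N" using l assms by simp
    show ?thesis
    proof (cases a)
      \<comment> \<open>Here each \<open>V\<close> has \<open>?N'\<close> elements, more than the
        \<open>?N\<close> positions opened before \<open>?m\<close>. The sum therefore vanishes, as
        \<open>raise\<close> does at \<open>0\<close>.\<close>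
      case 0
      have "(\<Sum>V\<in>?P a. \<Prod>u\<in>?T. ?w V u) = 0"
        by (rule sum.neutral) (use 0 N assms in \<open>auto intro!: prod_step_weight_eq_0\<close>)
      then show ?thesis using True 0 by simp
    next
      case (Suc b)
      then show ?thesis using True N Suc.IH by simp
    qed
  qed
  have T: "{t..<t + Suc j} = insert ?m ?T" by auto
  have fin: "finite (?P a)" for a by simp
  \<comment> \<open>Either \<open>?m\<close> is not in \<open>V\<close> and the state stays
    \<open>a\<close>, or it is in \<open>V\<close> and the state drops from \<open>Suc a\<close>:
    these are the two terms of \<open>lower\<close>.\<close>
  have split: "{V. V \<subseteq> {t..<t + Suc j} \<and> card V + a = ?N'} = ?P a \<union> insert ?m ` ?P (Suc a)" (is "?L = _")
  proof (intro equalityI subsetI)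
    fix V assume V: "V \<in> ?L"
    show "V \<in> ?P a \<union> insert ?m ` ?P (Suc a)"
    proof (cases "?m \<in> V")
      case True
      have finV: "finite V" using V by (auto intro: finite_subset)
      have "V = insert ?m (V - {?m})" using True by auto
      moreover have "V - {?m} \<in> ?P (Suc a)"
        using V card_Suc_Diff1[OF finV True] unfolding T by auto
      ultimately show ?thesis by blast
    next
      case False
      then have "V \<subseteq> ?T" using V unfolding T by blast
      then show ?thesis using V by simp
    qed
  next
    fix V assume "V \<in> ?P a \<union> insert ?m ` ?P (Suc a)"
    moreover have "insert ?m W \<in> ?L" if W: "W \<in> ?P (Suc a)" for W
    proof -
      have "finite W" "?m \<notin> W" using W by (auto intro: finite_subset)
      then show ?thesis using W by (auto simp: T)
    qed
    ultimately show "V \<in> ?L" by (auto simp: T)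
  qed
  have inj: "inj_on (insert ?m) (?P (Suc a))"
  proof (rule inj_onI)
    fix V W assume "V \<in> ?P (Suc a)" "W \<in> ?P (Suc a)" and eq: "insert ?m V = insert ?m W"
    then have "?m \<notin> V" "?m \<notin> W" by auto
    then show "V = W" using eq by (metis insert_ident)
  qed
  have opn: "card {i\<in>E. i + g \<le> ?m} = ?N'" by (simp add: less_Suc_eq_le)
  have "(\<Sum>V\<in>?L. \<Prod>u\<in>insert ?m ?T. ?w V u)
      = (\<Sum>V\<in>?P a. \<Prod>u\<in>insert ?m ?T. ?w V u) + (\<Sum>V\<in>insert ?m ` ?P (Suc a). \<Prod>u\<in>insert ?m ?T. ?w V u)"
    unfolding split by (rule sum.union_disjoint) (use fin in auto)
  also have "(\<Sum>V\<in>?P a. \<Prod>u\<in>insert ?m ?T. ?w V u) = (\<Sum>V\<in>?P a. qint q (g + a) * (\<Prod>u\<in>?T. ?w V u))"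
  proof (rule sum.cong[OF refl])
    fix V assume V: "V \<in> ?P a"
    have "{w\<in>V. w < ?m} = V" "?m \<notin> V" using V by auto
    moreover have "card V + a = ?N'" using V by blast
    then have "g + ?N' - card V = g + a" by linarith
    ultimately have "?w V ?m = qint q (g + a)" unfolding step_weight_def opn by (simp only: if_False)
    then show "(\<Prod>u\<in>insert ?m ?T. ?w V u) = qint q (g + a) * (\<Prod>u\<in>?T. ?w V u)" by simp
  qed
  also have "\<dots> = qint q (g + a) * ?f a"
    unfolding f sum_distrib_left ..
  also have "(\<Sum>V\<in>insert ?m ` ?P (Suc a). \<Prod>u\<in>insert ?m ?T. ?w V u)
      = (\<Sum>V\<in>?P (Suc a). \<Prod>u\<in>insert ?m ?T. ?w (insert ?m V) u)"
    by (subst sum.reindex[OF inj]) simp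
  also have "\<dots> = (\<Sum>V\<in>?P (Suc a). qint q (Suc a) * (\<Prod>u\<in>?T. ?w V u))"
  proof (rule sum.cong[OF refl])
    fix V assume V: "V \<in> ?P (Suc a)"
    have "{w\<in>insert ?m V. w < ?m} = V" using V by auto
    moreover have "card V + Suc a = ?N'" using V by blast
    then have "?N' - card V = Suc a" by linarith
    ultimately have "?w (insert ?m V) ?m = qint q (Suc a)"
      unfolding step_weight_def opn by (simp only: insertI1 if_True)
    moreover have "(\<Prod>u\<in>?T. ?w (insert ?m V) u) = (\<Prod>u\<in>?T. ?w V u)"
    proof (rule prod.cong[OF refl])
      fix u assume u: "u \<in> ?T"
      then have "{w\<in>insert ?m V. w < u} = {w\<in>V. w < u}" "u \<noteq> ?m" by auto
      then show "?w (insert ?m V) u = ?w V u" unfolding step_weight_def by simp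
    qed
    ultimately show "(\<Prod>u\<in>insert ?m ?T. ?w (insert ?m V) u) = qint q (Suc a) * (\<Prod>u\<in>?T. ?w V u)"
      by simp
  qed
  also have "\<dots> = qint q (Suc a) * ?f (Suc a)"
    unfolding f sum_distrib_left ..
  finally show ?case
    unfolding walk.simps lower_def T by (simp only:)
qed

section \<open>The recurrence\<close>

lemma card_split_at:
  fixes k :: nat
  assumes "finite E" "k \<notin> E"
  shows "card {i\<in>E. i < k} + card {i\<in>E. k < i} = card E"
proof -
  have "card ({i\<in>E. i < k} \<union> {i\<in>E. k < i}) = card {i\<in>E. i < k} + card {i\<in>E. k < i}"
    by (rule card_Un_disjoint) (use assms in auto)
  moreover have "i < k \<or> k < i" if "i \<in> E" for i
    using that assms(2) by (metis linorder_neqE_nat)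
  then have "{i\<in>E. i < k} \<union> {i\<in>E. k < i} = E" by auto
  ultimately show ?thesis by simp
qed

text \<open>No letter below \<open>max g h\<close> is an excedance letter, and such a letter
  \<open>u\<close> contributes \<open>qint q u\<close>. From there on the condition involving
  \<open>h\<close> is automatic and the factors are step weights. The bound \<open>Suc n\<close>
  admits the walk with no steps, which the recurrence can meet at size \<open>n - 1\<close>.\<close>

lemma exc_gf_eq_walk:
  fixes q :: "'r::comm_semiring_1"
  assumes "1 \<le> g" "1 \<le> h" "max g h \<le> Suc n" and E: "E \<subseteq> {1..n}" "\<And>i. i \<in> E \<Longrightarrow> i + g \<le> n"
  shows "exc_gf q g h n E
    = (\<Prod>u\<in>{1..<max g h}. qint q u) * walk q g (max g h) E (Suc n - max g h) 0"
proof -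
  define t where "t = max g h"
  have t: "1 \<le> t" "g \<le> t" "h \<le> t" "t \<le> Suc n" using assms by (auto simp: t_def)
  have finE: "finite E" using E(1) by (rule finite_subset) simp
  let ?A = "\<lambda>V v. qint q (card {i\<in>E. i + g \<le> v \<and> h \<le> v} - card {w\<in>V. w < v})"
  let ?B = "\<lambda>V u. qint q (card {i\<in>{1..n} - E. \<not> (i + g \<le> u \<and> h \<le> u)} - card {w\<in>{1..n} - V. u < w})"
  let ?W = "{V. V \<subseteq> {t..n} \<and> card V = card E}"
  have "exc_gf q g h n E = (\<Sum>V | V \<subseteq> {1..n} \<and> card V = card E. prod (?A V) V * prod (?B V) ({1..n} - V))"
    by (rule exc_gf_eq_sum_prod[OF E(1)])
  also have "\<dots> = (\<Sum>V\<in>?W. prod (?A V) V * prod (?B V) ({1..n} - V))"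
  proof (rule sum.mono_neutral_right)
    show "\<forall>V\<in>{V. V \<subseteq> {1..n} \<and> card V = card E} - ?W. prod (?A V) V * prod (?B V) ({1..n} - V) = 0"
    proof
      fix V assume V: "V \<in> {V. V \<subseteq> {1..n} \<and> card V = card E} - ?W"
      then obtain v where v: "v \<in> V" "v < t" by (auto simp: subset_iff)
      have none: "\<not> (i + g \<le> v \<and> h \<le> v)" if "i \<in> E" for i
        using that v E(1) by (auto simp: t_def)
      have "{i\<in>E. i + g \<le> v \<and> h \<le> v} = {}" using none by blast
      then have "?A V v = 0" by (simp only: card.empty diff_0_eq_0 qint_0)
      moreover have "finite V" using V by (auto intro: finite_subset)
      ultimately have "prod (?A V) V = 0" using v(1) by (intro prod_zero) auto
      then show "prod (?A V) V * prod (?B V) ({1..n} - V) = 0" by (simp only: mult_zero_left)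
    qed
  qed (use t in auto)
  also have "\<dots> = (\<Sum>V\<in>?W. (\<Prod>u\<in>{1..<t}. qint q u) * (\<Prod>u\<in>{t..n}. step_weight q g E V u))"
  proof (rule sum.cong[OF refl])
    fix V assume "V \<in> ?W"
    then have V: "V \<subseteq> {t..n}" and cV: "card V = card E" by auto
    have finV: "finite V" using V by (rule finite_subset) simp
    have A: "?A V v = step_weight q g E V v" if "v \<in> V" for v
      using that V t(3) by (auto simp: step_weight_def intro!: arg_cong[where f = "qint q"])
    have B: "card {w\<in>{1..n} - V. u < w} + card {w\<in>V. u < w} = n - u" if "u \<le> n" for u
    proof -
      have "{w\<in>{1..n} - V. u < w} \<union> {w\<in>V. u < w} = {u<..n}"
        using V t(1) by auto
      moreover have "card ({w\<in>{1..n} - V. u < w} \<union> {w\<in>V. u < w})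
          = card {w\<in>{1..n} - V. u < w} + card {w\<in>V. u < w}"
        by (rule card_Un_disjoint) (use finV in auto)
      ultimately show ?thesis by simp
    qed
    have low: "?B V u = qint q u" if u: "u \<in> {1..<t}" for u
    proof -
      have "\<not> (i + g \<le> u \<and> h \<le> u)" if "i \<in> {1..n} - E" for i
        using that u by (auto simp: t_def)
      then have "{i\<in>{1..n} - E. \<not> (i + g \<le> u \<and> h \<le> u)} = {1..n} - E" by blast
      then have "card {i\<in>{1..n} - E. \<not> (i + g \<le> u \<and> h \<le> u)} = n - card E"
        using E(1) finE by (simp add: card_Diff_subset)
      moreover have "{w\<in>V. u < w} = V" using V u by auto
      then have "card {w\<in>{1..n} - V. u < w} + card E = n - u"
        using B[of u] u t cV by auto
      moreover have "card E \<le> n" "u \<le> n" using card_mono[OF _ E(1)] u t by auto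
      ultimately have "card {i\<in>{1..n} - E. \<not> (i + g \<le> u \<and> h \<le> u)} - card {w\<in>{1..n} - V. u < w} = u"
        by linarith
      then show ?thesis by (simp only:)
    qed
    have high: "?B V u = step_weight q g E V u" if u: "u \<in> {t..n} - V" for u
    proof -
      \<comment> \<open>The positions that cannot hold \<open>u\<close> as an excedance letter are
        exactly those above \<open>u - g\<close>; they are sorted here by membership in
        \<open>E\<close>.\<close>
      have "{i\<in>{1..n} - E. \<not> (i + g \<le> u \<and> h \<le> u)} \<union> {i\<in>E. \<not> i + g \<le> u} = {u - g<..n}"
        using u t E(1) by auto
      moreover have "card ({i\<in>{1..n} - E. \<not> (i + g \<le> u \<and> h \<le> u)} \<union> {i\<in>E. \<not> i + g \<le> u})
          = card {i\<in>{1..n} - E. \<not> (i + g \<le> u \<and> h \<le> u)} + card {i\<in>E. \<not> i + g \<le> u}"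
        by (rule card_Un_disjoint) (use finE in auto)
      ultimately have 1: "card {i\<in>{1..n} - E. \<not> (i + g \<le> u \<and> h \<le> u)} + card {i\<in>E. \<not> i + g \<le> u} = n - (u - g)"
        by simp
      have "card ({i\<in>E. i + g \<le> u} \<union> {i\<in>E. \<not> i + g \<le> u}) = card {i\<in>E. i + g \<le> u} + card {i\<in>E. \<not> i + g \<le> u}"
        by (rule card_Un_disjoint) (use finE in auto)
      moreover have "{i\<in>E. i + g \<le> u} \<union> {i\<in>E. \<not> i + g \<le> u} = E" by auto
      ultimately have 2: "card {i\<in>E. i + g \<le> u} + card {i\<in>E. \<not> i + g \<le> u} = card E" by simp
      have 3: "card {w\<in>V. w < u} + card {w\<in>V. u < w} = card E"
        using card_split_at[OF finV, of u] u cV by simp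
      have u': "g \<le> u" "u \<le> n" using u t by auto
      then have "n - (u - g) + u = n + g" "n - u + u = n" by simp_all
      \<comment> \<open>In this additive form the identity yields equality of the truncated
        differences whether or not they are exact.\<close>
      then have "card {i\<in>{1..n} - E. \<not> (i + g \<le> u \<and> h \<le> u)} + card {w\<in>V. w < u}
          = card {w\<in>{1..n} - V. u < w} + (g + card {i\<in>E. i + g \<le> u})"
        using 1 2 3 B[OF u'(2)] by linarith
      then have "card {i\<in>{1..n} - E. \<not> (i + g \<le> u \<and> h \<le> u)} - card {w\<in>{1..n} - V. u < w}
          = g + card {i\<in>E. i + g \<le> u} - card {w\<in>V. w < u}"
        by linarith
      then show ?thesis using u by (simp add: step_weight_def)
    qed
    have "{1..n} - V = {1..<t} \<union> ({t..n} - V)" using V t by auto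
    then have "prod (?B V) ({1..n} - V) = prod (?B V) {1..<t} * prod (?B V) ({t..n} - V)"
      by (simp only:) (rule prod.union_disjoint; auto)
    also have "prod (?B V) {1..<t} = (\<Prod>u\<in>{1..<t}. qint q u)"
      by (rule prod.cong[OF refl]) (rule low)
    also have "prod (?B V) ({t..n} - V) = prod (step_weight q g E V) ({t..n} - V)"
      by (rule prod.cong[OF refl]) (rule high)
    finally have prodB: "prod (?B V) ({1..n} - V)
      = (\<Prod>u\<in>{1..<t}. qint q u) * prod (step_weight q g E V) ({t..n} - V)" .
    have prodA: "prod (?A V) V = prod (step_weight q g E V) V"
      by (rule prod.cong[OF refl]) (rule A)
    show "prod (?A V) V * prod (?B V) ({1..n} - V)
      = (\<Prod>u\<in>{1..<t}. qint q u) * (\<Prod>u\<in>{t..n}. step_weight q g E V u)"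
      unfolding prodA prodB
      by (subst prod.subset_diff[OF V, of "step_weight q g E V"]) (simp_all add: ac_simps)
  qed
  also have "\<dots> = (\<Prod>u\<in>{1..<t}. qint q u) * walk q g t E (Suc n - t) 0"
  proof -
    have "{t..<t + (Suc n - t)} = {t..n}" using t by auto
    moreover have "{i\<in>E. i + g < t + (Suc n - t)} = E" using t E(2) by (auto simp: less_Suc_eq_le)
    ultimately show ?thesis
      unfolding walk_eq_sum[OF finE] sum_distrib_left by simp
  qed
  finally show ?thesis unfolding t_def .
qed

lemma exc_gf_eq_0:
  assumes "i \<in> E" and "n < i + g"
  shows "exc_gf q g h n E = 0"
proof -
  have "Exclp g h n p \<noteq> E" if "p \<in> Sym n" for p
  proof
    assume "Exclp g h n p = E"
    then have "i \<in> {1..n}" "i + g \<le> p i" using assms(1) by (auto simp: Exclp_def)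
    moreover have "p i \<le> n"
      using permutes_in_image[of p "{1..n}" i] that \<open>i \<in> {1..n}\<close> by (simp add: Sym_def)
    ultimately show False using assms(2) by simp
  qed
  then have "{p. p \<in> Sym n \<and> Exclp g h n p = E} = {}" by auto
  then show ?thesis unfolding exc_gf_def by (simp only: sum.empty)
qed

text \<open>Passing from \<open>n - 1\<close> to \<open>n\<close> appends one step to the walk with
  the same prefactor, and \<open>lower_walk\<close> moves the new \<open>lower\<close> through. If
  \<open>n - g\<close> is in \<open>E\<close>, that step also opens a position, and evaluation at
  \<open>0\<close> leaves a single term.\<close>

lemma exc_gf_rec:
  fixes q :: "'r::comm_semiring_1"
  assumes "1 \<le> g" "1 \<le> h" "g \<le> n" "h \<le> n"
    and E: "E \<subseteq> {1..n}" "\<And>i. i \<in> E \<Longrightarrow> i + g \<le> n"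
  shows "exc_gf q g h n E = qint q (card E + g) * exc_gf q g h (n - 1) E
    + (\<Sum>k\<in>E. q ^ card {i\<in>E. k < i} * exc_gf q g h (n - 1) (E - {k}))"
proof -
  define t where "t = max g h"
  define j where "j = n - t"
  define C where "C = (\<Prod>u\<in>{1..<t}. qint q u)"
  have t: "1 \<le> t" "t \<le> n" using assms by (auto simp: t_def)
  have n: "t + j = n" "Suc n - t = Suc j" "Suc (n - 1) - t = j" "n - t = j" using t by (auto simp: j_def)
  have finE: "finite E" using E(1) by (rule finite_subset) simp
  have gf: "exc_gf q g h n E = C * walk q g t E (Suc j) 0"
    using exc_gf_eq_walk[of g h n E q] assms t by (simp add: C_def t_def[symmetric] n)
  have gf': "exc_gf q g h (n - 1) E' = C * walk q g t E' j 0"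
    if "E' \<subseteq> E" "\<And>i. i \<in> E' \<Longrightarrow> i + g \<noteq> n" for E'
  proof -
    have E': "i + g \<le> n - 1" if "i \<in> E'" for i
      using \<open>E' \<subseteq> E\<close> E(2)[of i] \<open>i \<in> E' \<Longrightarrow> i + g \<noteq> n\<close> that by auto
    have "E' \<subseteq> {1..n - 1}" using E' E(1) \<open>E' \<subseteq> E\<close> by force
    then show ?thesis
      using exc_gf_eq_walk[of g h "n - 1" E' q] E' assms(1,2) t by (simp add: C_def t_def[symmetric] n)
  qed
  show ?thesis
  proof (cases "\<exists>i\<in>E. i + g = n")
    case False
    have lt: "i + g < n" if "i \<in> E" for i using E(2)[OF that] False that by (metis le_neq_implies_less)
    have 1: "{i\<in>E. i + g < t + j} = E" "{i\<in>E. k < i \<and> i + g < t + j} = {i\<in>E. k < i}" for k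
      using lt by (auto simp: n)
    have "walk q g t E (Suc j) 0 = lower q g (walk q g t E j) 0"
      using False by (simp add: n)
    also have "\<dots> = qint q (g + card E) * walk q g t E j 0
        + (\<Sum>k\<in>E. q ^ card {i\<in>E. k < i} * walk q g t (E - {k}) j 0)"
      unfolding lower_walk[OF finE] 1 ..
    finally have "exc_gf q g h n E = qint q (card E + g) * (C * walk q g t E j 0)
        + (\<Sum>k\<in>E. q ^ card {i\<in>E. k < i} * (C * walk q g t (E - {k}) j 0))"
      unfolding gf by (simp add: algebra_simps sum_distrib_left)
    also have "\<dots> = qint q (card E + g) * exc_gf q g h (n - 1) E
        + (\<Sum>k\<in>E. q ^ card {i\<in>E. k < i} * exc_gf q g h (n - 1) (E - {k}))"
    proof -
      have "exc_gf q g h (n - 1) E = C * walk q g t E j 0"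
        by (rule gf') (use False in auto)
      moreover have "exc_gf q g h (n - 1) (E - {k}) = C * walk q g t (E - {k}) j 0" for k
        by (rule gf') (use False in auto)
      ultimately show ?thesis by (simp only:)
    qed
    finally show ?thesis .
  next
    case True
    then obtain l where l: "l \<in> E" "l + g = n" by auto
    \<comment> \<open>At \<open>0\<close> only the summand \<open>1\<close> of the commutation
      relation survives. In the claimed recurrence, only the term \<open>k = l\<close> has a set
      that is feasible for \<open>n - 1\<close>.\<close>
    have "walk q g t E (Suc j) 0 = lower q g (raise (walk q g t E j)) 0"
      using True by (simp add: n)
    also have "\<dots> = walk q g t E j 0"
      unfolding lower_raise by simp
    also have "\<dots> = walk q g t (E - {l}) j 0"
      by (rule fun_cong[OF walk_cong]) (use l in \<open>auto simp: n\<close>)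
    finally have "exc_gf q g h n E = exc_gf q g h (n - 1) (E - {l})"
      unfolding gf using l by (subst gf') auto
    moreover have "exc_gf q g h (n - 1) E = 0"
      by (rule exc_gf_eq_0[OF l(1)]) (use l t in auto)
    moreover have "(\<Sum>k\<in>E. q ^ card {i\<in>E. k < i} * exc_gf q g h (n - 1) (E - {k}))
        = exc_gf q g h (n - 1) (E - {l})"
    proof -
      have "(\<Sum>k\<in>E. q ^ card {i\<in>E. k < i} * exc_gf q g h (n - 1) (E - {k}))
          = (\<Sum>k\<in>{l}. q ^ card {i\<in>E. k < i} * exc_gf q g h (n - 1) (E - {k}))"
      proof (rule sum.mono_neutral_right)
        show "\<forall>k\<in>E - {l}. q ^ card {i\<in>E. k < i} * exc_gf q g h (n - 1) (E - {k}) = 0"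
        proof
          fix k assume "k \<in> E - {l}"
          then have "exc_gf q g h (n - 1) (E - {k}) = 0"
            by (intro exc_gf_eq_0[of l]) (use l t in auto)
          then show "q ^ card {i\<in>E. k < i} * exc_gf q g h (n - 1) (E - {k}) = 0" by simp
        qed
      qed (use finE l in auto)
      moreover have "{i\<in>E. l < i} = {}" using E(2) l(2) by fastforce
      ultimately show ?thesis by simp
    qed
    ultimately show ?thesis by simp
  qed
qed

text \<open>Below \<open>g\<close> there are no excedances, so the sum is a q-factorial. This covers
  the sizes left out by \<open>exc_gf_rec\<close>.\<close>

lemma exc_gf_rec_empty:
  fixes q :: "'r::comm_semiring_1"
  assumes "n < g" and "1 \<le> n"
  shows "exc_gf q g h n {} = qint q n * exc_gf q g h (n - 1) {}"
proof -
  have prod: "exc_gf q g h m {} = (\<Prod>u\<in>{1..m}. qint q u)" if "m < g" for m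
  proof -
    have V: "{V. V \<subseteq> {1..m} \<and> card V = 0} = {{}}" by (auto dest: finite_subset)
    have "exc_gf q g h m {}
        = (\<Prod>u\<in>{1..m}. qint q (card {i\<in>{1..m}. \<not> (i + g \<le> u \<and> h \<le> u)} - card {w\<in>{1..m}. u < w}))"
      unfolding exc_gf_eq_sum_prod[OF empty_subsetI] card.empty V by simp
    also have "\<dots> = (\<Prod>u\<in>{1..m}. qint q u)"
    proof (rule prod.cong[OF refl])
      fix u assume u: "u \<in> {1..m}"
      have "{i\<in>{1..m}. \<not> (i + g \<le> u \<and> h \<le> u)} = {1..m}" using u that by auto
      moreover have "{w\<in>{1..m}. u < w} = {u<..m}" using u by auto
      ultimately show "qint q (card {i\<in>{1..m}. \<not> (i + g \<le> u \<and> h \<le> u)} - card {w\<in>{1..m}. u < w}) = qint q u"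
        using u by simp
    qed
    finally show ?thesis .
  qed
  obtain m where "n = Suc m" using assms(2) by (cases n) auto
  then show ?thesis using assms(1) by (simp add: prod mult.commute)
qed

section \<open>Subwords and ranks\<close>

text \<open>In an increasing list of positions, comparing indices is the same as comparing the
  positions themselves.\<close>

lemma word_inv_map:
  assumes "sorted_wrt (<) xs"
  shows "word_inv (map p xs) = key_inv int int (set xs) p"
proof -
  let ?A = "{(i, j). i < j \<and> j < length xs \<and> p (xs ! i) > p (xs ! j)}"
  let ?B = "{(x, y). x \<in> set xs \<and> y \<in> set xs \<and> int x < int y \<and> int (p x) > int (p y)}"
  let ?f = "\<lambda>(i, j). (xs ! i, xs ! j)"
  have less: "xs ! i < xs ! j \<longleftrightarrow> i < j" if "i < length xs" "j < length xs" for i j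
    using that assms by (metis linorder_neqE_nat order_less_asym sorted_wrt_nth_less)
  have "distinct xs" using assms strict_sorted_iff by blast
  then have "inj_on ?f ?A" by (auto simp: inj_on_def nth_eq_iff_index_eq)
  moreover have "?f ` ?A = ?B"
  proof (intro equalityI subsetI)
    fix z assume "z \<in> ?B"
    then obtain i j where "i < length xs" "j < length xs" "z = ?f (i, j)"
      "xs ! i < xs ! j" "p (xs ! i) > p (xs ! j)"
      by (auto simp: in_set_conv_nth)
    then show "z \<in> ?f ` ?A" using less[of i j] by (intro image_eqI[of _ _ "(i, j)"]) auto
  qed (use less in auto)
  moreover have "word_inv (map p xs) = card ?A"
    unfolding word_inv_def by (rule arg_cong[where f = card]) auto
  ultimately show ?thesis unfolding key_inv_def using card_image by fastforce
qed

lemma den_eq: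
  "den g h m p = (\<Sum>i\<in>Exclp g h m p. i + g - 1)
    + (key_inv int int (Exclp g h m p) p + key_inv int int ({1..m} - Exclp g h m p) p)"
proof -
  have "set (filter (\<lambda>i. i \<in> Exclp g h m p) [1..<Suc m]) = Exclp g h m p"
    "set (filter (\<lambda>i. i \<notin> Exclp g h m p) [1..<Suc m]) = {1..m} - Exclp g h m p"
    by (auto simp: Exclp_def)
  moreover have "sorted_wrt (<) (filter P [1..<Suc m])" for P
    by (rule sorted_wrt_filter) (rule sorted_wrt_upt)
  ultimately show ?thesis
    unfolding den_def EXCL_def NEXCL_def by (simp only: word_inv_map add.assoc)
qed

lemma sum_power_den:
  "(\<Sum>p | p \<in> Sym n \<and> Exclp g h n p = E. q ^ den g h n p)
    = q ^ (\<Sum>i\<in>E. i + g - 1) * exc_gf q g h n E"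
  unfolding exc_gf_def sum_distrib_left
  by (rule sum.cong) (auto simp: den_eq power_add)

lemma Exclp_bound:
  assumes "p \<in> Sym m" and "i \<in> Exclp g h m p"
  shows "i \<in> {1..m}" and "i + g \<le> m"
proof -
  show "i \<in> {1..m}" using assms(2) by (simp add: Exclp_def)
  then have "p i \<le> m" using assms(1) permutes_in_image[of p "{1..m}" i] by (simp add: Sym_def)
  then show "i + g \<le> m" using assms(2) by (simp add: Exclp_def)
qed

text \<open>Replaces list indexing by a rank condition, which determines an element of
  \<open>A\<close> because ranks increase strictly.\<close>

lemma nth_smallest_rank:
  assumes "finite A" "1 \<le> d" "d \<le> card A"
  shows "nth_smallest A d \<in> A" and "card {x\<in>A. x < nth_smallest A d} = d - 1"
proof -
  let ?xs = "sorted_list_of_set A"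
  have set: "set ?xs = A" and len: "length ?xs = card A" and dist: "distinct ?xs"
    and sorted: "sorted_wrt (<) ?xs"
    using assms(1) by auto
  have d: "d - 1 < length ?xs" using assms(2,3) len by simp
  show "nth_smallest A d \<in> A"
    unfolding nth_smallest_def using nth_mem[OF d] set by simp
  have less: "?xs ! i < ?xs ! j \<longleftrightarrow> i < j" if "i < length ?xs" "j < length ?xs" for i j
    using that sorted by (metis linorder_neqE_nat order_less_asym sorted_wrt_nth_less)
  have "{x\<in>A. x < nth_smallest A d} = (!) ?xs ` {..<d - 1}"
  proof (intro equalityI subsetI)
    fix x assume "x \<in> {x\<in>A. x < nth_smallest A d}"
    then obtain i where "i < length ?xs" "x = ?xs ! i" "?xs ! i < ?xs ! (d - 1)"
      using set by (metis (mono_tags, lifting) in_set_conv_nth mem_Collect_eq nth_smallest_def)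
    then show "x \<in> (!) ?xs ` {..<d - 1}" using less d by auto
  next
    fix x assume "x \<in> (!) ?xs ` {..<d - 1}"
    then obtain i where i: "i < d - 1" "x = ?xs ! i" by auto
    then have "i < length ?xs" using d by simp
    then show "x \<in> {x\<in>A. x < nth_smallest A d}"
      unfolding nth_smallest_def using i less[of i "d - 1"] d set nth_mem by auto
  qed
  moreover have "inj_on ((!) ?xs) {..<d - 1}"
    using dist d by (auto simp: inj_on_def nth_eq_iff_index_eq)
  ultimately show "card {x\<in>A. x < nth_smallest A d} = d - 1"
    by (simp add: card_image)
qed

section \<open>Correspondence between the values of \<open>c\<close> and the inserted
  positions\<close>

lemma card_below_compl:
  fixes k :: nat
  assumes "E \<subseteq> {1..m}" "1 \<le> k" "k \<le> m"
  shows "card {x\<in>{1..m} - E. x < k} + card {i\<in>E. i < k} = k - 1"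
proof -
  have "finite E" using assms(1) by (rule finite_subset) simp
  then have "card ({x\<in>{1..m} - E. x < k} \<union> {i\<in>E. i < k}) = card {x\<in>{1..m} - E. x < k} + card {i\<in>E. i < k}"
    by (intro card_Un_disjoint) auto
  moreover have "{x\<in>{1..m} - E. x < k} \<union> {i\<in>E. i < k} = {1..<k}" using assms by auto
  ultimately show ?thesis by simp
qed

text \<open>The rank of \<open>k\<close> in the complement is \<open>k - 1\<close> minus the number
  of elements of \<open>E\<close> below \<open>k\<close>. Equating it with
  \<open>c - card E - g\<close> and solving for \<open>c\<close> leaves the elements of
  \<open>E\<close> above \<open>k\<close>.\<close>

lemma nth_smallest_compl_iff:
  assumes "1 \<le> g" "E \<subseteq> {1..m}" "\<And>i. i \<in> E \<Longrightarrow> i + g \<le> m"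
  shows "c \<le> m \<and> card E + g \<le> c \<and> nth_smallest ({1..m} - E) (c - card E - g + 1) = k
    \<longleftrightarrow> k \<notin> E \<and> 1 \<le> k \<and> k + g \<le> Suc m \<and> c = k + g - 1 + card {i\<in>E. k < i}" (is "?L \<longleftrightarrow> ?R")
proof -
  let ?A = "{1..m} - E"
  have finE: "finite E" using assms(2) by (rule finite_subset) simp
  have cardA: "card ?A = m - card E" using assms(2) finE by (simp add: card_Diff_subset)
  have rank: "nth_smallest ?A (c - card E - g + 1) \<in> ?A"
      "card {x\<in>?A. x < nth_smallest ?A (c - card E - g + 1)} = c - card E - g"
    if "c \<le> m" "card E + g \<le> c"
  proof -
    have "1 \<le> c - card E - g + 1" "c - card E - g + 1 \<le> card ?A"
      using that assms(1) cardA by linarith+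
    from nth_smallest_rank[OF _ this]
    show "nth_smallest ?A (c - card E - g + 1) \<in> ?A"
      "card {x\<in>?A. x < nth_smallest ?A (c - card E - g + 1)} = c - card E - g"
      by simp_all
  qed
  show ?thesis
  proof
    assume L: ?L
    have k: "k \<notin> E" "1 \<le> k" "k \<le> m" and r: "card {x\<in>?A. x < k} = c - card E - g"
      using L rank by auto
    have "c = k + g - 1 + card {i\<in>E. k < i}"
      using L r card_split_at[OF finE k(1)] card_below_compl[OF assms(2) k(2,3)] k(2) by linarith
    then show ?R using k L assms(1) by auto
  next
    assume R: ?R
    \<comment> \<open>The elements of \<open>E\<close> above \<open>k\<close> are at most
      \<open>m - g\<close>, which bounds the cardinality occurring in \<open>c\<close>.\<close>
    have c: "c \<le> m"
    proof (cases "k + g = Suc m")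
      case True
      then have "{i\<in>E. k < i} = {}" using assms(3) by fastforce
      then have "card {i\<in>E. k < i} = 0" by (simp only: card.empty)
      then show ?thesis using R True by simp
    next
      case False
      have "{i\<in>E. k < i} \<subseteq> {k<..m - g}" using assms(3) by fastforce
      then have "card {i\<in>E. k < i} \<le> m - g - k" using card_mono[of "{k<..m - g}"] by simp
      moreover have "k + g \<le> m" using R False by simp
      moreover have "c = k + g - 1 + card {i\<in>E. k < i}" using R by simp
      ultimately show ?thesis by linarith
    qed
    have k: "k \<le> m" using R assms(1) by simp
    have s: "card {i\<in>E. i < k} + card {i\<in>E. k < i} = card E"
      using R by (intro card_split_at finE) simp
    have b: "card {x\<in>?A. x < k} + card {i\<in>E. i < k} = k - 1"
      using R k by (intro card_below_compl assms(2)) auto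
    have ge: "card E + g \<le> c" and r: "card {x\<in>?A. x < k} = c - card E - g"
      using R s b by linarith+
    let ?k = "nth_smallest ?A (c - card E - g + 1)"
    have eq: "card {x\<in>?A. x < k} = card {x\<in>?A. x < ?k}" using rank(2)[OF c ge] r by simp
    have mono: "card {x\<in>?A. x < a} < card {x\<in>?A. x < b}" if "a \<in> ?A" "a < b" for a b
      using rank_less[of ?A a "\<lambda>x. x" b] that by (simp only: finite_Diff finite_atLeastAtMost)
    have "?k = k"
    proof (cases ?k k rule: linorder_cases)
      case less
      from mono[OF rank(1)[OF c ge] this] show ?thesis unfolding eq by simp
    next
      case greater
      have "k \<in> ?A" using R k by simp
      from mono[OF this greater] show ?thesis unfolding eq by simp
    qed
    then show ?L using c ge by simp
  qed
qed

text \<open>The excedance set prescribed for the image, with \<open>m\<close> standing for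
  \<open>n - 1\<close>. It depends on \<open>E\<close> and \<open>c\<close> alone, so its fibres can
  be counted before any bijection exists.\<close>

definition ins_set :: "nat \<Rightarrow> nat \<Rightarrow> nat set \<Rightarrow> nat \<Rightarrow> nat set" where
  "ins_set g m E c = (if c \<le> card E + g - 1 then E
     else E \<union> {nth_smallest ({1..m} - E) (c - card E - g + 1)})"

text \<open>Reading the prescription backwards gives the coefficients of the recurrence: an initial
  segment of values \<open>c\<close> keeps the set, and each admissible \<open>k\<close> is added by
  exactly one \<open>c\<close>. For \<open>Suc m < g\<close> the segment is cut off at
  \<open>Suc m\<close>, the number of available values.\<close>

lemma ins_set_fibre:
  assumes "1 \<le> g" "E \<subseteq> {1..m}" "\<And>i. i \<in> E \<Longrightarrow> i + g \<le> m"
  shows "{c\<in>{0..m}. ins_set g m E c = E} = {..<if Suc m < g then Suc m else card E + g}"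
    and "k \<notin> E \<Longrightarrow> 1 \<le> k \<Longrightarrow> k + g \<le> Suc m \<Longrightarrow>
      {c\<in>{0..m}. ins_set g m E c = insert k E} = {k + g - 1 + card {i\<in>E. k < i}}"
    and "c \<le> m \<Longrightarrow> ins_set g m E c = E \<or>
      (\<exists>k. k \<notin> E \<and> 1 \<le> k \<and> k + g \<le> Suc m \<and> ins_set g m E c = insert k E)"
proof -
  note iff = nth_smallest_compl_iff[OF assms]
  have big: "c \<le> card E + g - 1 \<or> card E + g \<le> c" for c by linarith
  have new: "ins_set g m E c = insert (nth_smallest ({1..m} - E) (c - card E - g + 1)) E"
    "nth_smallest ({1..m} - E) (c - card E - g + 1) \<notin> E" if "c \<le> m" "card E + g \<le> c" for c
  proof -
    show "nth_smallest ({1..m} - E) (c - card E - g + 1) \<notin> E"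
      by (rule iff[THEN iffD1, THEN conjunct1, OF _ conjI[OF that(1) conjI[OF that(2) refl]]])
    have "\<not> c \<le> card E + g - 1" using that(2) assms(1) by linarith
    then show "ins_set g m E c = insert (nth_smallest ({1..m} - E) (c - card E - g + 1)) E"
      unfolding ins_set_def by simp
  qed
  have old: "ins_set g m E c = E \<longleftrightarrow> c < card E + g" if "c \<le> m" for c
    using new[OF that] assms(1) that by (cases "c < card E + g") (auto simp: ins_set_def)
  have "{c\<in>{0..m}. ins_set g m E c = E} = {c\<in>{0..m}. c < card E + g}" using old by auto
  also have "\<dots> = {..<if Suc m < g then Suc m else card E + g}"
  \<comment> \<open>A nonempty \<open>E\<close> lies in \<open>{1..m - g}\<close>, so the
    \<open>card E + g\<close> values all fit into the range of \<open>c\<close>.\<close>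
  proof (cases "E = {}")
    case False
    then obtain i where "i \<in> E" by auto
    then have "g \<le> m" using assms(3)[of i] by simp
    moreover have "E \<subseteq> {1..m - g}" using assms(2,3) by force
    then have "card E \<le> m - g" using card_mono[of "{1..m - g}" E] by simp
    ultimately show ?thesis by auto
  qed auto
  finally show "{c\<in>{0..m}. ins_set g m E c = E} = {..<if Suc m < g then Suc m else card E + g}" .
  show "{c\<in>{0..m}. ins_set g m E c = insert k E} = {k + g - 1 + card {i\<in>E. k < i}}"
    if k: "k \<notin> E" "1 \<le> k" "k + g \<le> Suc m"
  proof -
    have "c \<le> m \<and> ins_set g m E c = insert k E \<longleftrightarrow> c = k + g - 1 + card {i\<in>E. k < i}" for c
    proof -
      have step: "ins_set g m E c = insert k E \<longleftrightarrow>
          card E + g \<le> c \<and> nth_smallest ({1..m} - E) (c - card E - g + 1) = k" if c: "c \<le> m"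
      proof (cases "card E + g \<le> c")
        case True
        then show ?thesis using new[OF c True] k(1) by (simp only: insert_ident simp_thms) blast
      next
        case False
        then show ?thesis using old[OF c] k(1) by auto
      qed
      show ?thesis
      proof (cases "c \<le> m")
        case True
        show ?thesis using iff[of c k] k by (simp only: step[OF True] True simp_thms)
      next
        case False
        show ?thesis using iff[of c k] k by (simp only: False simp_thms)
      qed
    qed
    then show ?thesis by auto
  qed
  show "ins_set g m E c = E \<or>
      (\<exists>k. k \<notin> E \<and> 1 \<le> k \<and> k + g \<le> Suc m \<and> ins_set g m E c = insert k E)" if "c \<le> m"
  proof (cases "c < card E + g")
    case False
    then show ?thesis
      using new(1)[of c] iff[of c "nth_smallest ({1..m} - E) (c - card E - g + 1)"] that
      by (intro disjI2 exI[of _ "nth_smallest ({1..m} - E) (c - card E - g + 1)"]) simp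
  qed (use old that in simp)
qed

section \<open>The bijection\<close>

lemma finite_Sym: "finite (Sym n)"
  unfolding Sym_def by (rule finite_permutations) simp

text \<open>This is the recurrence for \<open>exc_gf\<close> multiplied by the constant position
  factor of \<open>E\<close>. The pairs are grouped by their source set, which must be
  \<open>E\<close> or some \<open>E - {k}\<close>.\<close>

lemma sum_ins_set_fibre:
  fixes q :: "'r::comm_semiring_1"
  assumes "1 \<le> g" "1 \<le> h" "1 \<le> n" "h \<le> n" and E: "E \<subseteq> {1..n}" "\<And>i. i \<in> E \<Longrightarrow> i + g \<le> n"
  shows "(\<Sum>(\<sigma>, c) | \<sigma> \<in> Sym (n - 1) \<and> c \<in> {0..n - 1} \<and> ins_set g (n - 1) (Exclp g h (n - 1) \<sigma>) c = E.
      q ^ (den g h (n - 1) \<sigma> + c)) = (\<Sum>p | p \<in> Sym n \<and> Exclp g h n p = E. q ^ den g h n p)"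
proof -
  define m where "m = n - 1"
  have n: "n = Suc m" using assms(3) by (simp add: m_def)
  let ?X = "Exclp g h m" and ?d = "den g h m"
  let ?ck = "\<lambda>k. k + g - 1 + card {i\<in>E. k < i}"
  let ?w = "if Suc m < g then Suc m else card E + g"
  have finE: "finite E" using E(1) by (rule finite_subset) simp
  have rec: "exc_gf q g h n E = qint q ?w * exc_gf q g h m E
    + (\<Sum>k\<in>E. q ^ card {i\<in>E. k < i} * exc_gf q g h m (E - {k}))"
  proof (cases "n < g")
    case True
    then have "E = {}" using E by fastforce
    then show ?thesis using exc_gf_rec_empty[OF True assms(3)] True n by simp
  next
    case False
    then show ?thesis using exc_gf_rec[of g h n E q] assms n by simp
  qed
  have inner: "(\<Sum>c | c \<in> {0..m} \<and> ins_set g m (?X \<sigma>) c = E. q ^ (?d \<sigma> + c))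
      = (if ?X \<sigma> = E then qint q ?w * q ^ ?d \<sigma> else 0)
        + (\<Sum>k\<in>E. if ?X \<sigma> = E - {k} then q ^ ?ck k * q ^ ?d \<sigma> else 0)" if \<sigma>: "\<sigma> \<in> Sym m" for \<sigma>
  proof -
    note X = Exclp_bound[OF \<sigma>, where g = g and h = h]
    have X1: "?X \<sigma> \<subseteq> {1..m}" using X(1) by blast
    consider "?X \<sigma> = E" | l where "l \<in> E" "?X \<sigma> = E - {l}"
      | "?X \<sigma> \<noteq> E" "\<And>k. k \<in> E \<Longrightarrow> ?X \<sigma> \<noteq> E - {k}" by blast
    then show ?thesis
    proof cases
      case 1
      have "(\<Sum>k\<in>E. if ?X \<sigma> = E - {k} then q ^ ?ck k * q ^ ?d \<sigma> else 0) = 0"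
        by (rule sum.neutral) (use 1 in auto)
      moreover have "{c. c \<in> {0..m} \<and> ins_set g m (?X \<sigma>) c = E} = {..<?w}"
        using ins_set_fibre(1)[OF assms(1) X1 X(2)] 1 by simp
      ultimately show ?thesis
        using 1 by (simp add: qint_def sum_distrib_left sum_distrib_right power_add mult.commute)
    next
      case 2
      have eq: "?X \<sigma> = E - {k} \<longleftrightarrow> k = l" if "k \<in> E" for k using 2 that by auto
      have "(\<Sum>k\<in>E. if ?X \<sigma> = E - {k} then q ^ ?ck k * q ^ ?d \<sigma> else 0)
          = (\<Sum>k\<in>E. if k = l then q ^ ?ck k * q ^ ?d \<sigma> else 0)"
        by (rule sum.cong[OF refl]) (simp only: eq)
      also have "\<dots> = q ^ ?ck l * q ^ ?d \<sigma>" using finE 2(1) by simp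
      finally have s: "(\<Sum>k\<in>E. if ?X \<sigma> = E - {k} then q ^ ?ck k * q ^ ?d \<sigma> else 0)
          = q ^ ?ck l * q ^ ?d \<sigma>" .
      have l: "l \<notin> ?X \<sigma>" "insert l (?X \<sigma>) = E" "1 \<le> l" "l + g \<le> Suc m"
        using 2 E(1) E(2)[OF 2(1)] n by (simp_all add: insert_absorb subset_iff)
      have "{i\<in>?X \<sigma>. l < i} = {i\<in>E. l < i}" using 2 by auto
      then have "{c. c \<in> {0..m} \<and> ins_set g m (?X \<sigma>) c = E} = {?ck l}"
        using ins_set_fibre(2)[OF assms(1) X1 X(2) l(1,3,4)] l(2) by simp
      then show ?thesis
        unfolding s using 2 l(1) by (auto simp: power_add mult.commute)
    next
      case 3
      have "ins_set g m (?X \<sigma>) c \<noteq> E" if c: "c \<le> m" for c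
      proof
        assume "ins_set g m (?X \<sigma>) c = E"
        then obtain k where "k \<notin> ?X \<sigma>" "insert k (?X \<sigma>) = E"
          using ins_set_fibre(3)[OF assms(1) X1 X(2) c] 3(1) by auto
        then show False using 3(2)[of k] by auto
      qed
      then have empty: "{c. c \<in> {0..m} \<and> ins_set g m (?X \<sigma>) c = E} = {}" by auto
      have zero: "(\<Sum>k\<in>E. if ?X \<sigma> = E - {k} then q ^ ?ck k * q ^ ?d \<sigma> else 0) = 0"
        by (rule sum.neutral) (use 3 in auto)
      show ?thesis unfolding empty zero using 3(1) by simp
    qed
  qed
  \<comment> \<open>The part \<open>k + g - 1\<close> of \<open>c\<close> is precisely the position
    term of \<open>den\<close> that the source set lacks.\<close>
  have shift: "q ^ ?ck k * q ^ (\<Sum>i\<in>E - {k}. i + g - 1)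
      = q ^ (\<Sum>i\<in>E. i + g - 1) * q ^ card {i\<in>E. k < i}" if "k \<in> E" for k
    using finE that by (simp add: sum.remove power_add ac_simps)
  have D: "(\<Sum>\<sigma>\<in>Sym m. if ?X \<sigma> = F then a * q ^ ?d \<sigma> else 0)
      = a * (q ^ (\<Sum>i\<in>F. i + g - 1) * exc_gf q g h m F)" for a F
    unfolding sum_power_den[symmetric] sum_distrib_left
    by (rule sum.mono_neutral_cong_right) (auto simp: finite_Sym)
  have "{(\<sigma>, c). \<sigma> \<in> Sym m \<and> c \<in> {0..m} \<and> ins_set g m (?X \<sigma>) c = E}
      = Sigma (Sym m) (\<lambda>\<sigma>. {c. c \<in> {0..m} \<and> ins_set g m (?X \<sigma>) c = E})" by auto
  then have "(\<Sum>(\<sigma>, c) | \<sigma> \<in> Sym m \<and> c \<in> {0..m} \<and> ins_set g m (?X \<sigma>) c = E. q ^ (?d \<sigma> + c))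
      = (\<Sum>\<sigma>\<in>Sym m. \<Sum>c | c \<in> {0..m} \<and> ins_set g m (?X \<sigma>) c = E. q ^ (?d \<sigma> + c))"
    by (simp only:) (rule sum.Sigma[symmetric]; simp add: finite_Sym)
  also have "\<dots> = (\<Sum>\<sigma>\<in>Sym m. (if ?X \<sigma> = E then qint q ?w * q ^ ?d \<sigma> else 0)
        + (\<Sum>k\<in>E. if ?X \<sigma> = E - {k} then q ^ ?ck k * q ^ ?d \<sigma> else 0))"
    by (rule sum.cong[OF refl]) (rule inner)
  also have "\<dots> = qint q ?w * (q ^ (\<Sum>i\<in>E. i + g - 1) * exc_gf q g h m E)
      + (\<Sum>k\<in>E. q ^ ?ck k * (q ^ (\<Sum>i\<in>E - {k}. i + g - 1) * exc_gf q g h m (E - {k})))"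
    unfolding sum.distrib by (subst sum.swap) (simp only: D)
  also have "\<dots> = qint q ?w * (q ^ (\<Sum>i\<in>E. i + g - 1) * exc_gf q g h m E)
      + (\<Sum>k\<in>E. q ^ (\<Sum>i\<in>E. i + g - 1) * (q ^ card {i\<in>E. k < i} * exc_gf q g h m (E - {k})))"
    unfolding mult.assoc[symmetric] using shift by simp
  also have "\<dots> = q ^ (\<Sum>i\<in>E. i + g - 1) * exc_gf q g h n E"
    unfolding rec by (simp only: distrib_left sum_distrib_left mult.left_commute)
  also have "\<dots> = (\<Sum>p | p \<in> Sym n \<and> Exclp g h n p = E. q ^ den g h n p)"
    by (rule sum_power_den[symmetric])
  finally show ?thesis unfolding m_def .
qed

text \<open>Taking the indeterminate for \<open>q\<close> turns an equality of generating functions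
  into equalities of cardinalities, one for each value of the statistic.\<close>

lemma coeff_sum_power_X:
  "finite A \<Longrightarrow> coeff (\<Sum>x\<in>A. [:0, 1 :: nat:] ^ f x) k = card {x\<in>A. f x = k}"
proof -
  assume "finite A"
  have "coeff ([:0, 1 :: nat:] ^ f x) k = (if f x = k then 1 else 0)" for x
    using monom_altdef[of "1 :: nat" "f x"] by (metis coeff_monom smult_1_left)
  then show ?thesis
    using \<open>finite A\<close> by (simp add: coeff_sum sum.If_cases Int_def)
qed

text \<open>A bijection is chosen on each pair of equally large fibres; as the fibres partition both
  sets, the choices glue together.\<close>

lemma ex_bij_betw_fibres:
  assumes "finite A" "finite B" "\<And>y. card {x\<in>A. f x = y} = card {x\<in>B. f' x = y}"
  shows "\<exists>\<phi>. bij_betw \<phi> A B \<and> (\<forall>x\<in>A. f' (\<phi> x) = f x)"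
proof -
  have "\<exists>\<psi>. bij_betw \<psi> {x\<in>A. f x = y} {x\<in>B. f' x = y}" for y
    by (rule finite_same_card_bij) (use assms in auto)
  then have "\<exists>\<psi>. \<forall>y. bij_betw (\<psi> y) {x\<in>A. f x = y} {x\<in>B. f' x = y}" by (intro choice allI)
  then obtain \<psi> where \<psi>: "\<And>y. bij_betw (\<psi> y) {x\<in>A. f x = y} {x\<in>B. f' x = y}" by blast
  let ?\<phi> = "\<lambda>x. \<psi> (f x) x"
  have mem: "?\<phi> x \<in> B \<and> f' (?\<phi> x) = f x" if "x \<in> A" for x
    using bij_betw_apply[OF \<psi>, of x "f x"] that by simp
  have "inj_on ?\<phi> A"
  proof (rule inj_onI)
    fix x y assume xy: "x \<in> A" "y \<in> A" "?\<phi> x = ?\<phi> y"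
    then have "f x = f y" using mem by metis
    then show "x = y"
      using xy bij_betw_imp_inj_on[OF \<psi>[of "f x"]] by (auto dest: inj_onD)
  qed
  moreover have "B \<subseteq> ?\<phi> ` A"
  proof
    fix b assume "b \<in> B"
    then have "b \<in> \<psi> (f' b) ` {x\<in>A. f x = f' b}"
      unfolding bij_betw_imp_surj_on[OF \<psi>[of "f' b"]] by simp
    then obtain x where "x \<in> A" "f x = f' b" "b = \<psi> (f' b) x"
      by blast
    then show "b \<in> ?\<phi> ` A" by force
  qed
  ultimately have "bij_betw ?\<phi> A B" using mem by (auto simp: bij_betw_def)
  then show ?thesis using mem by blast
qed

theorem theorem4p1:
  fixes g h n :: nat
  assumes "g \<ge> 1" and "n \<ge> 1" and "1 \<le> h" and "h \<le> n"
  shows "\<exists>\<phi> :: (nat \<Rightarrow> nat) \<times> nat \<Rightarrow> (nat \<Rightarrow> nat).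
    bij_betw \<phi> (Sym (n - 1) \<times> {0..n - 1}) (Sym n) \<and>
    (\<forall>\<sigma> \<in> Sym (n - 1). \<forall>c \<in> {0..n - 1}.
      Exclp g h n (\<phi> (\<sigma>, c)) =
        (if c \<le> card (Exclp g h (n - 1) \<sigma>) + g - 1
         then Exclp g h (n - 1) \<sigma>
         else Exclp g h (n - 1) \<sigma> \<union>
           {nth_smallest ({1..n - 1} - Exclp g h (n - 1) \<sigma>)
              (c - card (Exclp g h (n - 1) \<sigma>) - g + 1)}) \<and>
      den g h n (\<phi> (\<sigma>, c)) = den g h (n - 1) \<sigma> + c)"
proof -
  let ?A = "Sym (n - 1) \<times> {0..n - 1}"
  let ?s = "\<lambda>(\<sigma>, c). ins_set g (n - 1) (Exclp g h (n - 1) \<sigma>) c"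
  let ?d = "\<lambda>(\<sigma>, c). den g h (n - 1) \<sigma> + c"
  \<comment> \<open>The two required identities are combined into one statistic with values in
    pairs, so that only its fibres need to be counted.\<close>
  have "\<exists>\<phi>. bij_betw \<phi> ?A (Sym n) \<and>
      (\<forall>x\<in>?A. (\<lambda>p. (Exclp g h n p, den g h n p)) (\<phi> x) = (?s x, ?d x))"
  proof (rule ex_bij_betw_fibres)
    fix y :: "nat set \<times> nat"
    obtain E k where y: "y = (E, k)" by (cases y)
    let ?A' = "{x\<in>?A. ?s x = E}" and ?B' = "{p\<in>Sym n. Exclp g h n p = E}"
    have fin: "finite ?A'" "finite ?B'" by (simp_all add: finite_Sym)
    have "(\<Sum>x\<in>?A'. [:0, 1 :: nat:] ^ ?d x) = (\<Sum>p\<in>?B'. [:0, 1 :: nat:] ^ den g h n p)"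
    proof (cases "\<forall>i\<in>E. i \<in> {1..n} \<and> i + g \<le> n")
      case True
      have "?A' = {(\<sigma>, c). \<sigma> \<in> Sym (n - 1) \<and> c \<in> {0..n - 1} \<and> ins_set g (n - 1) (Exclp g h (n - 1) \<sigma>) c = E}"
        by auto
      moreover have "E \<subseteq> {1..n}" "\<And>i. i \<in> E \<Longrightarrow> i + g \<le> n" using True by blast+
      note sum_ins_set_fibre[OF assms(1,3,2,4) this, of "[:0, 1 :: nat:]"]
      ultimately show ?thesis by (simp add: case_prod_unfold)
    next
      case False
      \<comment> \<open>Such an \<open>E\<close> is the excedance set of no permutation of size
        \<open>n\<close>, and no pair is assigned it either, so both sums are empty.\<close>
      have "?s (\<sigma>, c) \<noteq> E" if \<sigma>: "\<sigma> \<in> Sym (n - 1)" and c: "c \<le> n - 1" for \<sigma> c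
      proof
        assume eq: "?s (\<sigma>, c) = E"
        note X = Exclp_bound[OF \<sigma>, where g = g and h = h]
        have X1: "Exclp g h (n - 1) \<sigma> \<subseteq> {1..n - 1}" using X(1) by blast
        have old: "i \<in> {1..n} \<and> i + g \<le> n" if "i \<in> Exclp g h (n - 1) \<sigma>" for i
          using X[OF that] by auto
        from ins_set_fibre(3)[OF assms(1) X1 X(2) c]
        have "E \<subseteq> Exclp g h (n - 1) \<sigma> \<or> (\<exists>k. 1 \<le> k \<and> k + g \<le> n \<and> E \<subseteq> insert k (Exclp g h (n - 1) \<sigma>))"
          using eq assms(2) by auto
        then have "\<forall>i\<in>E. i \<in> {1..n} \<and> i + g \<le> n" using old by fastforce
        then show False using False by blast
      qed
      then have "?A' = {}" by auto
      moreover have "?B' = {}" using False Exclp_bound[where m = n] by blast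
      ultimately show ?thesis by (simp only: sum.empty)
    qed
    then have "card {x\<in>?A'. ?d x = k} = card {p\<in>?B'. den g h n p = k}"
      using coeff_sum_power_X[OF fin(1), of ?d k] coeff_sum_power_X[OF fin(2), of "den g h n" k] by simp
    moreover have "{x\<in>?A. (?s x, ?d x) = y} = {x\<in>?A'. ?d x = k}" using y by auto
    moreover have "{p\<in>Sym n. (Exclp g h n p, den g h n p) = y} = {p\<in>?B'. den g h n p = k}"
      using y by auto
    ultimately show "card {x\<in>?A. (?s x, ?d x) = y} = card {p\<in>Sym n. (Exclp g h n p, den g h n p) = y}"
      by (simp only:)
  qed (simp_all add: finite_Sym)
  then obtain \<phi> where "bij_betw \<phi> ?A (Sym n)"
    and "\<And>\<sigma> c. \<sigma> \<in> Sym (n - 1) \<Longrightarrow> c \<in> {0..n - 1} \<Longrightarrow>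
      Exclp g h n (\<phi> (\<sigma>, c)) = ins_set g (n - 1) (Exclp g h (n - 1) \<sigma>) c \<and>
      den g h n (\<phi> (\<sigma>, c)) = den g h (n - 1) \<sigma> + c"
    by force
  then show ?thesis unfolding ins_set_def by blast
qed

end
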